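(* Let $V\in\mathcal{O}_{\mathcal{L}}$ be a simple $\mathcal L$-module on which $z_3$ acts nontrivially. If $V$ contains a simple $\mathcal{H}$-submodule $H$, then $V\cong H(\dot z_2)\otimes U^{\mathcal{L}}$ as $\mathcal{L}$-modules for some $\dot z_2\in\mathbb{C}$ and some simple module $U\in\mathcal{O}_{\mathrm{Vir}}$.
   Context: $\mathcal{L}$ has basis $\{d_n,I_n,z_1,z_2,z_3\mid n\in\mathbb{Z}\}$ with brackets $[d_n,d_m]=(m-n)d_{m+n}+\delta_{n,-m}\frac{n^3-n}{12}z_1$, $[d_n,I_m]=mI_{m+n}+\delta_{n,-m}(n^2+n)z_2$, $[I_n,I_m]=n\delta_{n,-m}z_3$, $z_i$ central; $\mathrm{Vir}=\mathrm{span}\{d_i,z_1\}$, $\mathcal{H}=\mathrm{span}\{I_i,z_3\}$, graded by $\deg d_i=\deg I_i=i$, $\deg z_j=0$. For a graded Lie algebra $L=\bigoplus L_i$, $\mathcal{O}_L$ is the category of $L$-modules $V$ such that for every $v\in V$ there is $n>0$ with $L_iv=0$ for all $i\ge n$. For a $\mathrm{Vir}$-module $U$, $U^{\mathcal{L}}$ is the $\mathcal L$-module with $\mathbb{C}z_2+\mathcal{H}$ acting as $0$. For a simple $H\in\mathcal O_{\mathcal H}$ with $z_3$ acting as a nonzero scalar $\dot z_3$ and $\dot z_2\in\mathbb C$, $H(\dot z_2)$ is the $\mathcal L$-module on $H$ extending the $\mathcal H$-action with $z_1=1-12\dot z_2^2/\dot z_3$, $z_2=\dot z_2$, $z_3=\dot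 z_3$, $d_k=-\frac{1}{2\dot z_3}\sum_{i\in\mathbb Z}:I_{-i}I_{i+k}:+\frac{(k+1)\dot z_2}{\dot z_3}I_k$, where $:I_iI_j:=I_iI_j$ if $i<j$ and $=I_jI_i$ otherwise. *)

theory Defs
  imports Complex_Main "HOL-Library.Function_Algebras"
begin

datatype Lgen = D int | I int | Z1 | Z2 | Z3

text \<open>br x y g = coefficient of the basis element g in [x,y].\<close>
fun br :: "Lgen \<Rightarrow> Lgen \<Rightarrow> Lgen \<Rightarrow> complex" where
  "br (D n) (D m) g =
     (if g = D (m + n) then of_int (m - n) else 0)
   + (if g = Z1 \<and> n = - m then of_int (n ^ 3 - n) / 12 else 0)"
| "br (D n) (I m) g =
     (if g = I (m + n) then of_int m else 0)
   + (if g = Z2 \<and> n = - m then of_int (n ^ 2 + n) else 0)"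
| "br (I m) (D n) g =
   - ((if g = I (m + n) then of_int m else 0)
   + (if g = Z2 \<and> n = - m then of_int (n ^ 2 + n) else 0))"
| "br (I n) (I m) g = (if g = Z3 \<and> n = - m then of_int n else 0)"
| "br _ _ g = 0"

fun deg :: "Lgen \<Rightarrow> int" where
  "deg (D i) = i" | "deg (I i) = i" | "deg _ = 0"

definition Lgens :: "Lgen set" where "Lgens = UNIV"
definition Virgens :: "Lgen set" where "Virgens = range D \<union> {Z1}"
definition Hgens :: "Lgen set" where "Hgens = range I \<union> {Z3}"

definition lie_rep ::
  "Lgen set \<Rightarrow> (complex \<Rightarrow> 'a::ab_group_add \<Rightarrow> 'a) \<Rightarrow> 'a set \<Rightarrow> (Lgen \<Rightarrow> 'a \<Rightarrow> 'a) \<Rightarrow> bool" where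
  "lie_rep S sc C \<rho> \<longleftrightarrow>
     module.subspace sc C
   \<and> (\<forall>g\<in>S. \<forall>v\<in>C. \<rho> g v \<in> C)
   \<and> (\<forall>g\<in>S. \<forall>u\<in>C. \<forall>w\<in>C. \<forall>c. \<rho> g (u + w) = \<rho> g u + \<rho> g w \<and> \<rho> g (sc c u) = sc c (\<rho> g u))
   \<and> (\<forall>x\<in>S. \<forall>y\<in>S. \<forall>v\<in>C.
        \<rho> x (\<rho> y v) - \<rho> y (\<rho> x v) = (\<Sum>g\<in>{g. br x y g \<noteq> 0}. sc (br x y g) (\<rho> g v)))"

definition simple_rep ::
  "Lgen set \<Rightarrow> (complex \<Rightarrow> 'a::ab_group_add \<Rightarrow> 'a) \<Rightarrow> 'a set \<Rightarrow> (Lgen \<Rightarrow> 'a \<Rightarrow> 'a) \<Rightarrow> bool" where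
  "simple_rep S sc C \<rho> \<longleftrightarrow>
     lie_rep S sc C \<rho> \<and> C \<noteq> {0}
   \<and> (\<forall>W. module.subspace sc W \<and> W \<subseteq> C \<and> (\<forall>g\<in>S. \<forall>w\<in>W. \<rho> g w \<in> W)
          \<longrightarrow> W = {0} \<or> W = C)"

definition in_O :: "Lgen set \<Rightarrow> 'a::zero set \<Rightarrow> (Lgen \<Rightarrow> 'a \<Rightarrow> 'a) \<Rightarrow> bool" where
  "in_O S C \<rho> \<longleftrightarrow> (\<forall>v\<in>C. \<exists>n>0. \<forall>g\<in>S. deg g \<ge> n \<longrightarrow> \<rho> g v = 0)"

text \<open>Normal ordered product :I_{-i} I_{i+k}: applied to v.\<close>
definition nord :: "(int \<Rightarrow> 'a \<Rightarrow> 'a) \<Rightarrow> int \<Rightarrow> int \<Rightarrow> 'a \<Rightarrow> 'a" where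
  "nord \<rho>I k i v = (if - i < i + k then \<rho>I (- i) (\<rho>I (i + k) v) else \<rho>I (i + k) (\<rho>I (- i) v))"

text \<open>sum over i in Z of :I_{-i} I_{i+k}: v (only finitely many nonzero terms for modules in O_H).\<close>
definition sug :: "(int \<Rightarrow> 'a::ab_group_add \<Rightarrow> 'a) \<Rightarrow> int \<Rightarrow> 'a \<Rightarrow> 'a" where
  "sug \<rho>I k v = (\<Sum>i\<in>{i. nord \<rho>I k i v \<noteq> 0}. nord \<rho>I k i v)"

fun Hmod :: "(complex \<Rightarrow> 'a::ab_group_add \<Rightarrow> 'a) \<Rightarrow> (int \<Rightarrow> 'a \<Rightarrow> 'a) \<Rightarrow> complex \<Rightarrow> complex
    \<Rightarrow> Lgen \<Rightarrow> 'a \<Rightarrow> 'a" where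
  "Hmod sc \<rho>I dz2 dz3 (I n) v = \<rho>I n v"
| "Hmod sc \<rho>I dz2 dz3 Z3 v = sc dz3 v"
| "Hmod sc \<rho>I dz2 dz3 Z2 v = sc dz2 v"
| "Hmod sc \<rho>I dz2 dz3 Z1 v = sc (1 - 12 * dz2 ^ 2 / dz3) v"
| "Hmod sc \<rho>I dz2 dz3 (D k) v =
     sc (- 1 / (2 * dz3)) (sug \<rho>I k v) + sc ((of_int k + 1) * dz2 / dz3) (\<rho>I k v)"

fun Lext :: "(Lgen \<Rightarrow> 'a \<Rightarrow> 'a) \<Rightarrow> Lgen \<Rightarrow> 'a::zero \<Rightarrow> 'a" where
  "Lext \<rho> (D n) v = \<rho> (D n) v"
| "Lext \<rho> Z1 v = \<rho> Z1 v"
| "Lext \<rho> (I n) v = 0"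
| "Lext \<rho> Z2 v = 0"
| "Lext \<rho> Z3 v = 0"

definition fsc :: "complex \<Rightarrow> ('x \<Rightarrow> complex) \<Rightarrow> ('x \<Rightarrow> complex)" where
  "fsc c f = (\<lambda>x. c * f x)"

definition free_tens :: "'a set \<Rightarrow> 'b set \<Rightarrow> ('a \<times> 'b \<Rightarrow> complex) set" where
  "free_tens A B = {f. finite {p. f p \<noteq> 0} \<and> {p. f p \<noteq> 0} \<subseteq> A \<times> B}"

definition pt :: "'a \<Rightarrow> 'b \<Rightarrow> ('a \<times> 'b \<Rightarrow> complex)" where
  "pt a b = (\<lambda>q. if q = (a, b) then 1 else 0)"

definition tens_rel ::
  "(complex \<Rightarrow> 'a::ab_group_add \<Rightarrow> 'a) \<Rightarrow> (complex \<Rightarrow> 'b::ab_group_add \<Rightarrow> 'b) \<Rightarrow> 'a set \<Rightarrow> 'b set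
    \<Rightarrow> ('a \<times> 'b \<Rightarrow> complex) set" where
  "tens_rel sA sB A B =
     {pt (a + a') b - pt a b - pt a' b | a a' b. a \<in> A \<and> a' \<in> A \<and> b \<in> B}
   \<union> {pt a (b + b') - pt a b - pt a b' | a b b'. a \<in> A \<and> b \<in> B \<and> b' \<in> B}
   \<union> {pt (sA c a) b - fsc c (pt a b) | a b c. a \<in> A \<and> b \<in> B}
   \<union> {pt a (sB c b) - fsc c (pt a b) | a b c. a \<in> A \<and> b \<in> B}"

definition tens_sub where
  "tens_sub sA sB A B = module.span fsc (tens_rel sA sB A B)"

definition coset where
  "coset sA sB A B f = {f + r | r. r \<in> tens_sub sA sB A B}"

definition tens_carrier where
  "tens_carrier sA sB A B = coset sA sB A B ` free_tens A B"

definition tens_act ::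
  "(Lgen \<Rightarrow> 'a \<Rightarrow> 'a) \<Rightarrow> (Lgen \<Rightarrow> 'b \<Rightarrow> 'b) \<Rightarrow> Lgen \<Rightarrow> ('a \<times> 'b \<Rightarrow> complex) \<Rightarrow> ('a \<times> 'b \<Rightarrow> complex)" where
  "tens_act \<rho>A \<rho>B g f =
     (\<Sum>p\<in>{p. f p \<noteq> 0}. fsc (f p) (pt (\<rho>A g (fst p)) (snd p) + pt (fst p) (\<rho>B g (snd p))))"

definition iso_tensor ::
  "(complex \<Rightarrow> 'v::ab_group_add \<Rightarrow> 'v) \<Rightarrow> 'v set \<Rightarrow> (Lgen \<Rightarrow> 'v \<Rightarrow> 'v)
   \<Rightarrow> (complex \<Rightarrow> 'a::ab_group_add \<Rightarrow> 'a) \<Rightarrow> 'a set \<Rightarrow> (Lgen \<Rightarrow> 'a \<Rightarrow> 'a)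
   \<Rightarrow> (complex \<Rightarrow> 'b::ab_group_add \<Rightarrow> 'b) \<Rightarrow> 'b set \<Rightarrow> (Lgen \<Rightarrow> 'b \<Rightarrow> 'b) \<Rightarrow> bool" where
  "iso_tensor sV V \<rho>V sA A \<rho>A sB B \<rho>B \<longleftrightarrow>
    (\<exists>\<phi>. bij_betw \<phi> V (tens_carrier sA sB A B)
       \<and> (\<forall>x\<in>V. \<forall>y\<in>V. \<forall>f\<in>\<phi> x. \<forall>f'\<in>\<phi> y. \<phi> (x + y) = coset sA sB A B (f + f'))
       \<and> (\<forall>x\<in>V. \<forall>c. \<forall>f\<in>\<phi> x. \<phi> (sV c x) = coset sA sB A B (fsc c f))
       \<and> (\<forall>x\<in>V. \<forall>g. \<forall>f\<in>\<phi> x. \<phi> (\<rho>V g x) = coset sA sB A B (tens_act \<rho>A \<rho>B g f)))"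

end

theory Submission
  imports Defs "HOL-Analysis.Continuum_Not_Denumerable" "HOL-Computational_Algebra.Fundamental_Theorem_Algebra"
begin

text \<open>
  Since simple modules have countable dimension over \<open>\<complex>\<close>, Schur's lemma holds for them (Dixmier),
  so \<open>z\<^sub>2\<close> and \<open>z\<^sub>3\<close> act on \<open>V\<close> by scalars and all \<open>\<H>\<close>-endomorphisms of \<open>H\<close> are scalars.
  The oscillator formula for \<open>d\<^sub>k\<close> makes sense on all of \<open>V\<close> and has the same commutators with the
  \<open>I\<^sub>m\<close> as \<open>d\<^sub>k\<close>; hence the differences commute with \<open>\<H>\<close>, satisfy the Virasoro relations, and act
  on the multiplicity space \<open>U = Hom(H, V)\<close> of \<open>\<H>\<close>-homomorphisms. The evaluation map
  \<open>H \<otimes> U \<rightarrow> V\<close> is injective because \<open>End(H) = \<complex>\<close>, and its image is a nonzero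
  \<open>\<L>\<close>-submodule, hence all of \<open>V\<close>.
\<close>

section \<open>Schur's lemma in countable dimension\<close>

text \<open>The constants in the oscillator formula are dictated by the brackets. A mode commuted
  past the quadratic sum yields two equal terms, whence the factor \<open>-1/(2*z3)\<close>; the
  linear term \<open>(k+1)*z2/z3\<close> then produces the \<open>z2\<close> part of
  \<open>[d_n, I_m]\<close>. The quadratic part alone has central charge 1, and the linear term adds
  \<open>-12*z2^2/z3\<close>. It is not known in advance that \<open>V\<close> is a sum of copies of
  \<open>H\<close>; this emerges only from the simplicity of \<open>V\<close>. Simplicity of
  \<open>U\<close> also comes from there: a submodule \<open>W\<close> of \<open>U\<close> gives the
  submodule \<open>H \<otimes> W\<close> of \<open>V\<close>, and \<open>W\<close> can be recovered
  from it. Two encodings shape the rest. The witness \<open>U\<close> must consist of functions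
  \<open>'v \<Rightarrow> complex\<close>, so a homomorphism is stored as the coordinates of its
  value at one nonzero vector of \<open>H\<close>, which determines it. The tensor product consists
  of cosets of formal sums, so injectivity means that the kernel of evaluation is exactly the span
  of the bilinear relations; for this, formal sums are brought to a normal form over a basis of
  \<open>U\<close>.\<close>

lemma countable_Lgen: "countable (S :: Lgen set)"
proof -
  have "(UNIV :: Lgen set) \<subseteq> range D \<union> range I \<union> {Z1, Z2, Z3}"
    by (metis (no_types, lifting) Lgen.exhaust UnI1 UnI2 insertCI rangeI subsetI)
  then show ?thesis
    by (meson countable_Un countable_finite countable_image countable_subset countableI_type
        finite.emptyI finite.insertI subset_UNIV)
qed

lemma uncountable_complex: "uncountable (UNIV :: complex set)"
proof
  assume "countable (UNIV :: complex set)"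
  then have "countable (range complex_of_real)"
    by (rule countable_subset[rotated]) simp
  then have "countable (UNIV :: real set)"
    by (rule countable_image_inj_on) (simp add: inj_on_def)
  then show False
    using uncountable_UNIV_real by simp
qed

context vector_space
begin

text \<open>Each \<open>b\<close> lies in the span of a finite subset of \<open>W\<close>. There are
  countably many such subsets, and an independent set meets the span of each in finitely many
  vectors.\<close>

lemma independent_countable:
  assumes "independent B" "B \<subseteq> span W" "countable W"
  shows "countable B"
proof -
  have "B \<subseteq> (\<Union>F\<in>{F. finite F \<and> F \<subseteq> W}. B \<inter> span F)"
  proof
    fix b assume b: "b \<in> B"
    then obtain F where "finite F" "F \<subseteq> W" "b \<in> span F"
      using assms(2) span_explicit by (smt (verit) mem_Collect_eq span_base span_scale span_sum subsetD)
    then show "b \<in> (\<Union>F\<in>{F. finite F \<and> F \<subseteq> W}. B \<inter> span F)"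
      using b by auto
  qed
  moreover have "countable (\<Union>F\<in>{F. finite F \<and> F \<subseteq> W}. B \<inter> span F)"
  proof (rule countable_UN)
    show "countable {F. finite F \<and> F \<subseteq> W}"
      using assms(3) by (simp add: countable_Collect_finite_subset)
    fix F assume "F \<in> {F. finite F \<and> F \<subseteq> W}"
    then have "finite (B \<inter> span F)"
      using independent_span_bound[of F "B \<inter> span F"] assms(1) independent_mono by auto
    then show "countable (B \<inter> span F)"
      by (rule countable_finite)
  qed
  ultimately show ?thesis
    by (rule countable_subset)
qed

end

lemma simple_rep_subspace: "simple_rep S sc C \<rho> \<Longrightarrow> module.subspace sc C"
  by (simp add: simple_rep_def lie_rep_def)

lemma simple_rep_closed: "simple_rep S sc C \<rho> \<Longrightarrow> g \<in> S \<Longrightarrow> v \<in> C \<Longrightarrow> \<rho> g v \<in> C"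
  by (simp add: simple_rep_def lie_rep_def)

lemma simple_rep_add:
  "simple_rep S sc C \<rho> \<Longrightarrow> g \<in> S \<Longrightarrow> u \<in> C \<Longrightarrow> w \<in> C \<Longrightarrow> \<rho> g (u + w) = \<rho> g u + \<rho> g w"
  by (simp add: simple_rep_def lie_rep_def)

lemma simple_rep_scale:
  "simple_rep S sc C \<rho> \<Longrightarrow> g \<in> S \<Longrightarrow> u \<in> C \<Longrightarrow> \<rho> g (sc c u) = sc c (\<rho> g u)"
  by (simp add: simple_rep_def lie_rep_def)

lemma simple_rep_bracket:
  "simple_rep S sc C \<rho> \<Longrightarrow> x \<in> S \<Longrightarrow> y \<in> S \<Longrightarrow> v \<in> C \<Longrightarrow>
     \<rho> x (\<rho> y v) - \<rho> y (\<rho> x v) = (\<Sum>g\<in>{g. br x y g \<noteq> 0}. sc (br x y g) (\<rho> g v))"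
  by (simp add: simple_rep_def lie_rep_def)

lemma simple_rep_nonzero: "simple_rep S sc C \<rho> \<Longrightarrow> C \<noteq> {0}"
  by (simp add: simple_rep_def)

lemma simple_rep_submodule:
  assumes "simple_rep S sc C \<rho>" "module.subspace sc W" "W \<subseteq> C"
    and "\<And>g w. g \<in> S \<Longrightarrow> w \<in> W \<Longrightarrow> \<rho> g w \<in> W"
  shows "W = {0} \<or> W = C"
  using assms unfolding simple_rep_def by blast

locale simple_module = vector_space sc
  for sc :: "complex \<Rightarrow> 'v::ab_group_add \<Rightarrow> 'v" +
  fixes S C \<rho>
  assumes simple: "simple_rep S sc C \<rho>"
begin

lemmas subspaceC = simple_rep_subspace[OF simple]
lemmas closedC = simple_rep_closed[OF simple]

text \<open>The words applied to \<open>v\<close> span a nonzero submodule. Since there are only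
  countably many words, this bounds the dimension of \<open>C\<close>, which is what Schur's lemma
  needs.\<close>

lemma words_span:
  assumes v: "v \<in> C" "v \<noteq> 0"
  shows "C = span ((\<lambda>l. foldr \<rho> l v) ` lists S)" (is "_ = span ?W")
proof -
  have W: "foldr \<rho> l v \<in> C" if "l \<in> lists S" for l
    using that by (induction l) (auto intro: v closedC)
  then have sub: "span ?W \<subseteq> C"
    by (intro span_minimal subspaceC) auto
  have "\<rho> g w \<in> span ?W" if g: "g \<in> S" and w: "w \<in> span ?W" for g w
  proof -
    \<comment> \<open>Membership in \<open>C\<close> is carried through the induction because
      \<open>\<rho> g\<close> is linear only there.\<close>
    have "w \<in> C \<and> \<rho> g w \<in> span ?W"
      using w
    proof (induction rule: span_induct_alt)
      case base
      have "\<rho> g 0 = \<rho> g (sc 0 v)" by simp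
      also have "\<dots> = 0" using simple_rep_scale[OF simple g v(1), of 0] by simp
      finally show ?case by (simp add: span_zero subspace_0 subspaceC)
    next
      case (step c x y)
      then obtain l where l: "l \<in> lists S" "x = foldr \<rho> l v" by auto
      then have "\<rho> g x = foldr \<rho> (g # l) v" "g # l \<in> lists S"
        using g by auto
      then have gx: "\<rho> g x \<in> span ?W" by (metis imageI span_base)
      have x: "x \<in> C" using l W by simp
      have cx: "sc c x \<in> C" using x subspaceC by (simp add: subspace_scale)
      have "\<rho> g (sc c x + y) = sc c (\<rho> g x) + \<rho> g y"
        using step cx simple_rep_add[OF simple g] simple_rep_scale[OF simple g x] by simp
      then show ?case
        using gx step cx subspaceC by (auto intro: span_add span_scale subspace_add)
    qed
    then show ?thesis by simp
  qed
  then have "span ?W = {0} \<or> span ?W = C"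
    by (intro simple_rep_submodule[OF simple] sub) (auto simp: subspace_span)
  moreover have "v \<in> span ?W"
    by (rule span_base, rule image_eqI[of _ _ "[]"]) auto
  ultimately show ?thesis using v by auto
qed

end

section \<open>Polynomials in an endomorphism of a simple module\<close>

locale module_endo = simple_module sc S C \<rho>
  for sc :: "complex \<Rightarrow> 'v::ab_group_add \<Rightarrow> 'v" and S C \<rho> +
  fixes T :: "'v \<Rightarrow> 'v"
  assumes closedT: "v \<in> C \<Longrightarrow> T v \<in> C"
    and addT: "v \<in> C \<Longrightarrow> w \<in> C \<Longrightarrow> T (v + w) = T v + T w"
    and scaleT: "v \<in> C \<Longrightarrow> T (sc c v) = sc c (T v)"
    and commT: "g \<in> S \<Longrightarrow> v \<in> C \<Longrightarrow> T (\<rho> g v) = \<rho> g (T v)"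
begin

lemma zeroT: "T 0 = 0"
  using addT[of 0 0] subspaceC by (simp add: subspace_0)

text \<open>This is \<open>p(T) v\<close>, evaluated by Horner's scheme.\<close>

definition papp :: "complex poly \<Rightarrow> 'v \<Rightarrow> 'v" where
  "papp p = foldr (\<lambda>a f v. sc a v + T (f v)) (coeffs p) (\<lambda>v. 0)"

lemma papp_0: "papp 0 v = 0"
  by (simp add: papp_def)

lemma papp_pCons: "papp (pCons a p) v = sc a v + T (papp p v)"
  by (cases "p = 0 \<and> a = 0") (auto simp: papp_def cCons_def zeroT)

lemma papp_closed: "v \<in> C \<Longrightarrow> papp p v \<in> C"
  by (induction p)
    (use subspaceC in \<open>auto simp: papp_0 papp_pCons subspace_0 intro!: subspace_add subspace_scale closedT\<close>)

lemma papp_add: "v \<in> C \<Longrightarrow> papp (p + q) v = papp p v + papp q v"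
  by (induction p q rule: poly_induct2)
    (auto simp: papp_0 papp_pCons addT papp_closed scale_left_distrib)

lemma papp_smult: "v \<in> C \<Longrightarrow> papp (smult c p) v = sc c (papp p v)"
  by (induction p) (auto simp: papp_0 papp_pCons scaleT papp_closed scale_right_distrib)

lemma papp_mult: "v \<in> C \<Longrightarrow> papp (p * q) v = papp p (papp q v)"
  by (induction p) (auto simp: papp_0 papp_pCons papp_add papp_smult)

lemma papp_sum: "v \<in> C \<Longrightarrow> papp (\<Sum>i\<in>F. p i) v = (\<Sum>i\<in>F. papp (p i) v)"
  by (induction F rule: infinite_finite_induct) (auto simp: papp_0 papp_add)

lemma papp_vadd: "v \<in> C \<Longrightarrow> w \<in> C \<Longrightarrow> papp p (v + w) = papp p v + papp p w"
  by (induction p) (auto simp: papp_0 papp_pCons addT papp_closed scale_right_distrib)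

lemma papp_vscale: "v \<in> C \<Longrightarrow> papp p (sc c v) = sc c (papp p v)"
  by (induction p) (auto simp: papp_0 papp_pCons scaleT papp_closed scale_right_distrib mult.commute)

lemma papp_v0: "papp p 0 = 0"
  by (induction p) (auto simp: papp_0 papp_pCons zeroT)

lemma papp_vsum: "(\<And>i. i \<in> F \<Longrightarrow> v i \<in> C) \<Longrightarrow> papp p (\<Sum>i\<in>F. v i) = (\<Sum>i\<in>F. papp p (v i))"
proof (induction F rule: infinite_finite_induct)
  case (insert x F)
  then have "(\<Sum>i\<in>F. v i) \<in> C" by (intro subspace_sum subspaceC) auto
  with insert show ?case by (simp add: papp_vadd)
qed (auto simp: papp_v0)

text \<open>If \<open>T\<close> were not a scalar, the vectors \<open>(T - c)\<^sup>-\<^sup>1 v\<^sub>0\<close> for \<open>c \<in> \<complex>\<close> would be uncountably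
  many independent vectors in a space of countable dimension.\<close>

theorem endo_scalar: "\<exists>c. \<forall>v\<in>C. T v = sc c v"
proof (rule ccontr)
  assume no: "\<nexists>c. \<forall>v\<in>C. T v = sc c v"
  let ?K = "\<lambda>c. {v \<in> C. T v = sc c v}"
  have comm_scale: "\<rho> g (T v - sc c v) = T (\<rho> g v) - sc c (\<rho> g v)" if "g \<in> S" "v \<in> C" for g v c
  proof -
    have "\<rho> g (T v + sc (- c) v) = \<rho> g (T v) + sc (- c) (\<rho> g v)"
      using that subspaceC
      by (simp only: simple_rep_add[OF simple] simple_rep_scale[OF simple] closedT subspace_scale)
    then show ?thesis using that by (simp add: commT)
  qed
  \<comment> \<open>Kernel and image of \<open>T - c\<close> are submodules. As \<open>T\<close> is
    assumed to be no scalar, each \<open>T - c\<close> is bijective on \<open>C\<close>.\<close>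
  have ker: "?K c = {0}" for c
  proof -
    have "?K c = {0} \<or> ?K c = C"
    proof (rule simple_rep_submodule[OF simple])
      show "subspace (?K c)"
        using subspaceC
        by (auto simp: subspace_def zeroT addT scaleT scale_right_distrib mult.commute)
      show "\<rho> g w \<in> ?K c" if "g \<in> S" "w \<in> ?K c" for g w
        using that closedC simple_rep_scale[OF simple] by (auto simp: commT)
    qed auto
    then show ?thesis using no by blast
  qed
  let ?R = "\<lambda>c. (\<lambda>v. T v - sc c v) ` C"
  have im: "?R c = C" for c
  proof -
    have sub: "?R c \<subseteq> C"
      using subspaceC by (auto intro!: subspace_diff closedT subspace_scale)
    have "?R c = {0} \<or> ?R c = C"
    proof (rule simple_rep_submodule[OF simple _ sub])
      show "subspace (?R c)"
        unfolding subspace_def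
      proof (intro conjI ballI allI)
        show "0 \<in> ?R c"
          using subspaceC zeroT by (intro image_eqI[of _ _ 0]) (auto simp: subspace_0)
      next
        fix x y assume "x \<in> ?R c" "y \<in> ?R c"
        then obtain v w where "v \<in> C" "w \<in> C" "x = T v - sc c v" "y = T w - sc c w" by auto
        then show "x + y \<in> ?R c"
          using subspaceC by (intro image_eqI[of _ _ "v + w"]) (auto simp: addT scale_right_distrib subspace_add)
      next
        fix d x assume "x \<in> ?R c"
        then obtain v where "v \<in> C" "x = T v - sc c v" by auto
        then show "sc d x \<in> ?R c"
          using subspaceC
          by (intro image_eqI[of _ _ "sc d v"]) (auto simp: scaleT scale_right_diff_distrib mult.commute subspace_scale)
      qed
      show "\<rho> g w \<in> ?R c" if "g \<in> S" "w \<in> ?R c" for g w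
        using that closedC by (auto simp: comm_scale)
    qed
    moreover have "?R c \<noteq> {0}"
    proof
      assume eq: "?R c = {0}"
      have "T v = sc c v" if "v \<in> C" for v
      proof -
        have "T v - sc c v \<in> ?R c" using that by blast
        then show ?thesis using eq by simp
      qed
      then show False using no by blast
    qed
    ultimately show ?thesis by blast
  qed
  \<comment> \<open>Over the complex numbers \<open>p\<close> splits into linear factors, and each
    \<open>T - c\<close> is injective.\<close>
  have inj: "papp p v \<noteq> 0" if "p \<noteq> 0" "v \<in> C" "v \<noteq> 0" for p v
    using that
  proof (induction "degree p" arbitrary: p v)
    case 0
    then obtain a where "p = [:a:]" by (metis degree_eq_zeroE)
    with 0 show ?case by (auto simp: papp_pCons papp_0 zeroT)
  next
    case (Suc n)
    have "\<not> constant (poly p)"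
      using Suc(2) by (simp add: constant_degree)
    then obtain c where "poly p c = 0"
      using fundamental_theorem_of_algebra by blast
    then obtain q where q: "p = [:- c, 1:] * q"
      using poly_eq_0_iff_dvd by blast
    with Suc.prems have q0: "q \<noteq> 0" by auto
    then have "degree p = Suc (degree q)" by (simp add: q degree_mult_eq del: mult_pCons_left)
    then have "papp q v \<noteq> 0" using Suc q0 by auto
    moreover have "papp q v \<in> C" using Suc.prems papp_closed by auto
    ultimately have "T (papp q v) \<noteq> sc c (papp q v)"
      using ker[of c] by auto
    then show ?case
      using Suc.prems by (simp add: q papp_mult papp_pCons papp_0 zeroT del: mult_pCons_left)
  qed
  obtain v0 where v0: "v0 \<in> C" "v0 \<noteq> 0"
    using simple_rep_nonzero[OF simple] subspaceC subspace_0 by blast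
  have "\<exists>x. x \<in> C \<and> T x - sc c x = v0" for c
    using im[of c] v0(1) by (metis (no_types, lifting) imageE)
  then obtain x where x: "\<And>c. x c \<in> C" "\<And>c. T (x c) - sc c (x c) = v0"
    by metis
  have lin: "papp [:- c, 1:] (x c) = v0" for c
    using x(2)[of c] by (simp add: papp_pCons papp_0 zeroT)
  \<comment> \<open>Partial fractions: applying the product of all \<open>T - d\<close> with
    \<open>d \<in> F\<close> to a relation between the vectors \<open>x c\<close> clears
    denominators and leaves \<open>q(T) v0 = 0\<close>.\<close>
  have indep: "u c = 0" if F: "finite F" and c: "c \<in> F" and z: "(\<Sum>c\<in>F. sc (u c) (x c)) = 0" for F u c
  proof (rule ccontr)
    assume uc: "u c \<noteq> 0"
    define P where "P G = (\<Prod>c\<in>G. [:- c, 1:])" for G :: "complex set"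
    define q where "q = (\<Sum>c\<in>F. smult (u c) (P (F - {c})))"
    have Px: "papp (P F) (x c) = papp (P (F - {c})) v0" if "c \<in> F" for c
    proof -
      have "P F = P (F - {c}) * [:- c, 1:]"
        using F that unfolding P_def by (metis mult.commute prod.remove)
      then show ?thesis using x by (simp add: papp_mult lin del: mult_pCons_right)
    qed
    have "papp q v0 = (\<Sum>c\<in>F. sc (u c) (papp (P (F - {c})) v0))"
      using v0 by (simp add: q_def papp_sum papp_smult)
    also have "\<dots> = papp (P F) (\<Sum>c\<in>F. sc (u c) (x c))"
      using x subspaceC by (subst papp_vsum) (auto simp: papp_vscale Px subspace_scale intro!: sum.cong)
    finally have "papp q v0 = 0" using z by (simp add: papp_v0)
    \<comment> \<open>As in Lagrange interpolation, every summand of \<open>q\<close> except the one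
      belonging to \<open>c\<close> vanishes at \<open>c\<close>.\<close>
    moreover have "poly q c \<noteq> 0"
    proof -
      have "poly (P (F - {d})) c = 0" if "d \<in> F" "d \<noteq> c" for d
        using that F c by (auto simp: P_def poly_prod intro!: prod_zero)
      then have "poly q c = u c * poly (P (F - {c})) c"
        using F c by (auto simp: q_def poly_sum sum.remove[of _ c] intro!: sum.neutral)
      moreover have "poly (P (F - {c})) c \<noteq> 0"
        using F by (auto simp: P_def poly_prod)
      ultimately show ?thesis using uc by simp
    qed
    ultimately show False using inj[of q v0] v0 by (metis poly_0)
  qed
  \<comment> \<open>Independence concerns only the set \<open>range x\<close>; injectivity makes
    that set as large as the complex numbers.\<close>
  have "inj x"
  proof (rule injI)
    fix c d assume eq: "x c = x d"
    then have "sc (c - d) (x c) = 0"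
      using x(2)[of c] x(2)[of d] by (simp add: scale_left_diff_distrib algebra_simps)
    then have "c = d \<or> x c = 0" by simp
    moreover have "x c \<noteq> 0" using x(2)[of c] v0 zeroT by auto
    ultimately show "c = d" by simp
  qed
  have "independent (range x)"
  proof
    assume "dependent (range x)"
    then obtain F u b where F: "finite F" "F \<subseteq> range x" and z: "(\<Sum>b\<in>F. sc (u b) b) = 0"
      and b: "b \<in> F" "u b \<noteq> 0"
      unfolding dependent_explicit by blast
    obtain G where G: "F = x ` G" using F by (metis subset_imageE)
    have "finite G" using F G \<open>inj x\<close> by (metis finite_imageD inj_on_subset subset_UNIV)
    moreover have "(\<Sum>c\<in>G. sc (u (x c)) (x c)) = 0"
      using z G \<open>inj x\<close> by (simp add: sum.reindex inj_on_subset)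
    ultimately show False using indep[of G _ "\<lambda>c. u (x c)"] b G by auto
  qed
  moreover have "range x \<subseteq> span ((\<lambda>l. foldr \<rho> l v0) ` lists S)"
    using words_span[OF v0] x(1) by auto
  moreover have "countable ((\<lambda>l. foldr \<rho> l v0) ` lists S)"
    by (intro countable_image countable_lists countable_Lgen)
  ultimately have "countable (range x)"
    by (rule independent_countable)
  then have "countable (UNIV :: complex set)"
    using \<open>inj x\<close> by (rule countable_image_inj_on)
  then show False using uncountable_complex by simp
qed

end

section \<open>The oscillator representation of the Virasoro algebra\<close>

locale heisenberg = vector_space sc
  for sc :: "complex \<Rightarrow> 'v::ab_group_add \<Rightarrow> 'v" +
  fixes a :: "int \<Rightarrow> 'v \<Rightarrow> 'v" and z :: complex
  assumes a_add: "a n (v + w) = a n v + a n w"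
    and a_scale: "a n (sc c v) = sc c (a n v)"
    and a_comm: "a n (a m v) - a m (a n v) = (if n = - m then sc (of_int n * z) v else 0)"
    and z_nonzero: "z \<noteq> 0"
    and restricted: "\<exists>N. \<forall>n\<ge>N. a n v = 0"
begin

lemma a_zero: "a n 0 = 0"
  using a_scale[of n 0 0] by simp

lemma a_minus: "a n (v - w) = a n v - a n w"
  using a_add[of n "v - w" w] by (simp add: algebra_simps)

lemma a_neg: "a n (- v) = - a n v"
  using a_scale[of n "- 1" v] by simp

lemma a_sum: "a n (\<Sum>i\<in>F. f i) = (\<Sum>i\<in>F. a n (f i))"
  by (induction F rule: infinite_finite_induct) (auto simp: a_zero a_add)

lemma a_swap: "n + m \<noteq> 0 \<Longrightarrow> a n (a m v) = a m (a n v)"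
  using a_comm[of n m v] by (simp add: eq_neg_iff_add_eq_0)

lemma nord_swap: "k \<noteq> 0 \<Longrightarrow> nord a k i v = a (- i) (a (i + k) v)"
  unfolding nord_def by (auto intro: a_swap)

text \<open>The two modes can fail to commute only for \<open>k = 0\<close>, and then reordering
  costs \<open>[a (- i), a i]\<close> when \<open>i < 0\<close>. These corrections are the source of
  the central charge.\<close>

lemma nord_eq:
  "a (- i) (a (i + k) v) = nord a k i v + sc (if k = 0 \<and> i < 0 then - of_int i * z else 0) v"
proof (cases "k = 0")
  case True
  then show ?thesis
    using a_comm[of "- i" i v] by (auto simp: nord_def algebra_simps)
qed (simp add: nord_swap)

lemma nord_add: "nord a k i (v + w) = nord a k i v + nord a k i w"
  by (simp add: nord_def a_add)

lemma nord_scale: "nord a k i (sc c v) = sc c (nord a k i v)"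
  by (simp add: nord_def a_scale)

text \<open>Normal ordering puts the larger index on the right. For large
  \<open>\<bar>i\<bar>\<close> that index is beyond the point from which all modes kill
  \<open>v\<close>. Hence \<open>sug\<close> can be computed over any sufficiently large symmetric
  window.\<close>

lemma nord_cutoff: "\<exists>N. \<forall>i. N < \<bar>i\<bar> \<longrightarrow> nord a k i v = 0"
proof -
  obtain N where N: "\<And>n. n \<ge> N \<Longrightarrow> a n v = 0" using restricted by blast
  have "nord a k i v = 0" if "\<bar>N\<bar> + \<bar>k\<bar> < \<bar>i\<bar>" for i
    using that by (auto simp: nord_def a_zero N)
  then show ?thesis by blast
qed

lemma sug_eq:
  assumes "finite A" "\<And>i. i \<notin> A \<Longrightarrow> nord a k i v = 0"
  shows "sug a k v = (\<Sum>i\<in>A. nord a k i v)"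
  unfolding sug_def using assms by (intro sum.mono_neutral_left) auto

lemma sug_interval: "\<forall>i. N < \<bar>i\<bar> \<longrightarrow> nord a k i v = 0 \<Longrightarrow> sug a k v = (\<Sum>i\<in>{-N..N}. nord a k i v)"
  by (rule sug_eq) auto

lemma sug_add: "sug a k (v + w) = sug a k v + sug a k w"
proof -
  obtain N M where "\<forall>i. N < \<bar>i\<bar> \<longrightarrow> nord a k i v = 0" "\<forall>i. M < \<bar>i\<bar> \<longrightarrow> nord a k i w = 0"
    using nord_cutoff by metis
  then have "sug a k x = (\<Sum>i\<in>{- max N M..max N M}. nord a k i x)" if "x \<in> {v, w, v + w}" for x
    using that by (intro sug_interval) (auto simp: nord_add)
  then show ?thesis by (simp add: nord_add sum.distrib)
qed

lemma sug_scale: "sug a k (sc c v) = sc c (sug a k v)"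
proof -
  obtain N where "\<forall>i. N < \<bar>i\<bar> \<longrightarrow> nord a k i v = 0"
    using nord_cutoff by metis
  then have "sug a k x = (\<Sum>i\<in>{- N..N}. nord a k i x)" if "x \<in> {v, sc c v}" for x
    using that by (intro sug_interval) (auto simp: nord_scale)
  then show ?thesis by (simp add: nord_scale scale_sum_right)
qed

text \<open>The two indices add up to \<open>k\<close>, so the one on the right is at least
  \<open>k/2\<close>, uniformly in \<open>i\<close>. This is what later places \<open>U\<close> in
  the category O.\<close>

lemma sug_eventually_zero: "\<exists>N. \<forall>k\<ge>N. sug a k v = 0"
proof -
  obtain N where N: "\<And>n. n \<ge> N \<Longrightarrow> a n v = 0" using restricted by blast
  have "nord a k i v = 0" if "k \<ge> 2 * \<bar>N\<bar>" for i k
    using that by (auto simp: nord_def a_zero N)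
  then show ?thesis by (intro exI[of _ "2 * \<bar>N\<bar>"]) (simp add: sug_def)
qed

lemma a_comm_prod:
  "a p (a q (a m v)) - a m (a p (a q v)) =
     sc (if q = - m then of_int q * z else 0) (a p v) + sc (if p = - m then of_int p * z else 0) (a q v)"
proof -
  have "a p (a q (a m v)) - a m (a p (a q v)) =
    a p (a q (a m v) - a m (a q v)) + (a p (a m (a q v)) - a m (a p (a q v)))"
    by (simp add: a_minus)
  then show ?thesis
    by (auto simp: a_comm a_scale a_zero a_neg)
qed

text \<open>Commutators of modes are scalars, so both orderings give the same answer:
  \<open>a m\<close> meets its conjugate mode in the left or the right factor, at
  \<open>i = m\<close> and at \<open>i = - m - k\<close>.\<close>

lemma nord_comm:
  "nord a k i (a m v) - a m (nord a k i v) =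
     sc (if i = m then - of_int m * z else 0) (a (m + k) v)
   + sc (if i = - m - k then - of_int m * z else 0) (a (m + k) v)"
proof -
  have "- i = m + k \<longleftrightarrow> i = - m - k" "i + k = - m \<longleftrightarrow> i = - m - k" by auto
  then show ?thesis
    unfolding nord_def by (auto simp: a_comm_prod add_ac)
qed

lemma sug_comm: "sug a k (a m v) - a m (sug a k v) = sc (- 2 * z * of_int m) (a (m + k) v)"
proof -
  obtain N1 N2 where "\<forall>i. N1 < \<bar>i\<bar> \<longrightarrow> nord a k i v = 0" "\<forall>i. N2 < \<bar>i\<bar> \<longrightarrow> nord a k i (a m v) = 0"
    using nord_cutoff by metis
  \<comment> \<open>The summands \<open>\<bar>m\<bar>\<close> and \<open>\<bar>k\<bar>\<close>
    ensure that both exceptional indices \<open>m\<close> and \<open>- m - k\<close> lie in the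
    window.\<close>
  moreover define N where "N = \<bar>N1\<bar> + \<bar>N2\<bar> + \<bar>m\<bar> + \<bar>k\<bar>"
  ultimately have "\<forall>i. N < \<bar>i\<bar> \<longrightarrow> nord a k i v = 0" "\<forall>i. N < \<bar>i\<bar> \<longrightarrow> nord a k i (a m v) = 0"
    by (smt (verit))+
  then have "sug a k (a m v) - a m (sug a k v)
      = (\<Sum>i\<in>{-N..N}. nord a k i (a m v) - a m (nord a k i v))"
    by (simp add: sug_interval a_sum sum_subtractf)
  also have "\<dots> = sc (\<Sum>i\<in>{-N..N}. (if i = m then - of_int m * z else 0)
       + (if i = - m - k then - of_int m * z else 0)) (a (m + k) v)"
    by (simp only: nord_comm scale_left_distrib[symmetric] scale_sum_left)
  also have "(\<Sum>i\<in>{-N..N}. (if i = m then - of_int m * z else 0)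
       + (if i = - m - k then - of_int m * z else 0)) = - 2 * z * of_int m"
    by (subst sum.distrib, subst (1 2) sum.delta) (auto simp: N_def)
  finally show ?thesis .
qed

text \<open>The Sugawara operators. The factor cancels the \<open>- 2 * z\<close> in
  \<open>sug_comm\<close>, so that \<open>T k\<close> shifts the modes just as \<open>d_k\<close>
  does, up to the \<open>z2\<close> term.\<close>

definition T :: "int \<Rightarrow> 'v \<Rightarrow> 'v" where
  "T k v = sc (- 1 / (2 * z)) (sug a k v)"

lemma T_add: "T k (v + w) = T k v + T k w"
  by (simp add: T_def sug_add scale_right_distrib)

lemma T_scale: "T k (sc c v) = sc c (T k v)"
  by (simp add: T_def sug_scale mult.commute)

lemma T_zero: "T k 0 = 0"
  using T_scale[of k 0 0] by simp

lemma T_neg: "T n (- v) = - T n v"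
  using T_scale[of n "- 1" v] by simp

lemma T_sum: "T k (\<Sum>i\<in>F. f i) = (\<Sum>i\<in>F. T k (f i))"
  by (induction F rule: infinite_finite_induct) (auto simp: T_zero T_add)

lemma T_a: "T k (a m v) - a m (T k v) = sc (of_int m) (a (m + k) v)"
proof -
  have "T k (a m v) - a m (T k v) = sc (- 1 / (2 * z)) (sug a k (a m v) - a m (sug a k v))"
    by (simp only: T_def a_scale scale_right_diff_distrib)
  then show ?thesis
    unfolding sug_comm using z_nonzero by simp
qed

lemma T_prod:
  "T n (a p (a q v)) - a p (a q (T n v)) = sc (of_int p) (a (p + n) (a q v)) + sc (of_int q) (a p (a (q + n) v))"
proof -
  have "T n (a p (a q v)) - a p (a q (T n v)) =
     (T n (a p (a q v)) - a p (T n (a q v))) + a p (T n (a q v) - a q (T n v))"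
    by (simp add: a_minus)
  then show ?thesis by (simp only: T_a a_scale)
qed

text \<open>The right side is a discrete antiderivative taken between \<open>- N\<close> and
  \<open>l\<close>; the factor 6 keeps everything integral.\<close>

lemma sum_quadratic:
  fixes N l n :: int
  assumes "- N \<le> l"
  shows "6 * (\<Sum>i\<in>{-N..<l}. i * (i - n)) =
    ((l - 1) * l * (2 * l - 1) - 3 * n * l * (l - 1)) - ((- N - 1) * (- N) * (- 2 * N - 1) - 3 * n * (- N) * (- N - 1))"
  using assms
proof (induction l rule: int_ge_induct)
  case base
  then show ?case by simp
next
  case (step l)
  have "{-N..<l + 1} = insert l {-N..<l}" using step by auto
  then show ?case using step by (simp add: algebra_simps)
qed

text \<open>Both partial sums start at \<open>- N\<close>, so the dependence on the cutoff cancels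
  and only the stretch between \<open>0\<close> and \<open>n\<close> remains. It gives the cubic
  Virasoro cocycle.\<close>

lemma anomaly_sum:
  fixes n N :: int
  assumes "\<bar>n\<bar> \<le> N"
  shows "(\<Sum>i\<in>{-N..N}. (if i < n then i * (i - n) else 0) - (if i < 0 then i * (i - n) else 0)) * 6
     = - (n ^ 3 - n)"
proof -
  have *: "(\<Sum>i\<in>{-N..N}. if i < l then i * (i - n) else 0) = (\<Sum>i\<in>{-N..<l}. i * (i - n))"
    if "l \<le> N" for l
    using that by (intro sum.mono_neutral_cong_right) auto
  show ?thesis
    using assms sum_quadratic[of N n n] sum_quadratic[of N 0 n]
    by (simp add: sum_subtractf * algebra_simps power3_eq_cube)
qed

text \<open>Without normal ordering the sum for \<open>m + n = 0\<close> diverges; the central term arises because the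
  two halves of the commutator are cut off at places that differ by the shift \<open>n\<close>.\<close>

lemma T_sug_comm:
  assumes m: "m \<noteq> 0"
  shows "T n (sug a m v) - sug a m (T n v) = sc (of_int (m - n)) (sug a (m + n) v)
    + sc (if n = - m then - z * of_int (n ^ 3 - n) / 6 else 0) v"
proof -
  obtain N1 N2 N3 where "\<forall>i. N1 < \<bar>i\<bar> \<longrightarrow> nord a m i v = 0" "\<forall>i. N2 < \<bar>i\<bar> \<longrightarrow> nord a m i (T n v) = 0"
     "\<forall>i. N3 < \<bar>i\<bar> \<longrightarrow> nord a (m + n) i v = 0"
    using nord_cutoff by metis
  \<comment> \<open>The products of total index \<open>m + n\<close> vanish already beyond
    \<open>N - \<bar>n\<bar>\<close>, so shifting the summation by \<open>n\<close> loses no nonzero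
    term.\<close>
  moreover define N where "N = \<bar>N1\<bar> + \<bar>N2\<bar> + \<bar>N3\<bar> + \<bar>m\<bar> + \<bar>n\<bar>"
  ultimately have N: "\<forall>i. N < \<bar>i\<bar> \<longrightarrow> nord a m i v = 0" "\<forall>i. N < \<bar>i\<bar> \<longrightarrow> nord a m i (T n v) = 0"
      "\<forall>i. N - \<bar>n\<bar> < \<bar>i\<bar> \<longrightarrow> nord a (m + n) i v = 0" "\<bar>n\<bar> \<le> N"
    by (smt (verit))+
  let ?f = "\<lambda>i. nord a (m + n) i v"
  let ?e = "\<lambda>i. if n = - m \<and> i < 0 then - of_int i * z else 0"
  have f: "a (- i) (a (i + (m + n)) v) = ?f i + sc (?e i) v" for i
    by (auto simp: nord_eq)
  have shift: "(\<Sum>i\<in>{-N..N}. sc (- of_int i) (?f (i - n))) = (\<Sum>i\<in>{-N..N}. sc (- of_int (i + n)) (?f i))"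
  proof -
    have "(\<Sum>i\<in>{-N..N}. sc (- of_int i) (?f (i - n))) = (\<Sum>i\<in>{-N-n..N-n}. sc (- of_int (i + n)) (?f i))"
      by (rule sum.reindex_bij_witness[of _ "\<lambda>i. i + n" "\<lambda>i. i - n"]) auto
    also have "\<dots> = (\<Sum>i\<in>{-N-\<bar>n\<bar>..N+\<bar>n\<bar>}. sc (- of_int (i + n)) (?f i))"
      using N(3) by (intro sum.mono_neutral_left) auto
    also have "\<dots> = (\<Sum>i\<in>{-N..N}. sc (- of_int (i + n)) (?f i))"
      using N(3) by (intro sum.mono_neutral_right) auto
    finally show ?thesis .
  qed
  have "T n (sug a m v) - sug a m (T n v) = (\<Sum>i\<in>{-N..N}. T n (nord a m i v) - nord a m i (T n v))"
    using N by (simp add: sug_interval T_sum sum_subtractf)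
  \<comment> \<open>As \<open>m \<noteq> 0\<close>, \<open>nord a m i\<close> is the plain product
    and the Leibniz rule \<open>T_prod\<close> applies to it. The resulting products have total
    index \<open>m + n\<close>, possibly zero, and putting them back in normal order costs
    \<open>?e\<close>.\<close>
  also have "\<dots> = (\<Sum>i\<in>{-N..N}. sc (- of_int i) (?f (i - n) + sc (?e (i - n)) v) + sc (of_int (i + m)) (?f i + sc (?e i) v))"
  proof (rule sum.cong[OF refl])
    fix i
    have "T n (nord a m i v) - nord a m i (T n v)
      = sc (- of_int i) (a (- (i - n)) (a ((i - n) + (m + n)) v)) + sc (of_int (i + m)) (a (- i) (a (i + (m + n)) v))"
      using T_prod[of n "- i" "i + m" v] m by (simp add: nord_swap algebra_simps)
    then show "T n (nord a m i v) - nord a m i (T n v) =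
       sc (- of_int i) (?f (i - n) + sc (?e (i - n)) v) + sc (of_int (i + m)) (?f i + sc (?e i) v)"
      by (simp only: f)
  qed
  also have "\<dots> = (\<Sum>i\<in>{-N..N}. sc (- of_int i) (?f (i - n))) + (\<Sum>i\<in>{-N..N}. sc (of_int (i + m)) (?f i))
      + sc (\<Sum>i\<in>{-N..N}. - of_int i * ?e (i - n) + of_int (i + m) * ?e i) v"
    by (simp only: sum.distrib scale_right_distrib scale_left_distrib scale_scale scale_sum_left add_ac)
  also have "\<dots> = sc (of_int (m - n)) (sug a (m + n) v)
      + sc (\<Sum>i\<in>{-N..N}. - of_int i * ?e (i - n) + of_int (i + m) * ?e i) v"
  proof -
    have "sug a (m + n) v = (\<Sum>i\<in>{-N..N}. ?f i)"
      using N(3,4) by (intro sug_interval) auto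
    then show ?thesis
      unfolding shift sum.distrib[symmetric]
      by (simp add: scale_sum_right scale_left_distrib[symmetric])
  qed
  also have "(\<Sum>i\<in>{-N..N}. - of_int i * ?e (i - n) + of_int (i + m) * ?e i)
      = (if n = - m then - z * of_int (n ^ 3 - n) / 6 else 0)"
  proof (cases "n = - m")
    case True
    \<comment> \<open>The correction at \<open>i - n\<close> is active for \<open>i < n\<close>, the
      one at \<open>i\<close> for \<open>i < 0\<close>; they contribute
      \<open>z * i * (i - n)\<close> with opposite signs.\<close>
    have "(\<Sum>i\<in>{-N..N}. - of_int i * ?e (i - n) + of_int (i + m) * ?e i) =
        (\<Sum>i\<in>{-N..N}. z * of_int ((if i < n then i * (i - n) else 0) - (if i < 0 then i * (i - n) else 0)))"
      using True by (intro sum.cong refl) (auto simp: algebra_simps)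
    also have "\<dots> = z * of_int (\<Sum>i\<in>{-N..N}. (if i < n then i * (i - n) else 0) - (if i < 0 then i * (i - n) else 0))"
      by (simp only: of_int_sum sum_distrib_left)
    also have "\<dots> * 6 = z * of_int (- (n ^ 3 - n))"
      unfolding anomaly_sum[OF N(4), symmetric] by simp
    finally show ?thesis using True by (simp add: field_simps)
  qed auto
  finally show ?thesis .
qed

lemma T_T_nonzero:
  assumes "m \<noteq> 0"
  shows "T n (T m v) - T m (T n v) = sc (of_int (m - n)) (T (m + n) v)
    + sc (if n = - m then of_int (n ^ 3 - n) / 12 else 0) v"
proof -
  have "T n (T m v) - T m (T n v) = sc (- 1 / (2 * z)) (T n (sug a m v) - sug a m (T n v))"
    by (simp add: T_def[of m] T_scale T_neg scale_right_diff_distrib)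
  then show ?thesis
    unfolding T_sug_comm[OF assms]
    using z_nonzero by (auto simp: T_def scale_right_distrib mult.commute)
qed

text \<open>The expansion needs an index different from zero in the operator that is written out as
  a sum. If \<open>m = 0\<close>, antisymmetry lets \<open>n\<close> take that place, unless both
  indices vanish and there is nothing to prove.\<close>

lemma T_T:
  "T n (T m v) - T m (T n v) = sc (of_int (m - n)) (T (m + n) v)
    + sc (if n = - m then of_int (n ^ 3 - n) / 12 else 0) v"
proof (cases "m = 0")
  case True
  show ?thesis
  proof (cases "n = 0")
    case False
    have "T n (T m v) - T m (T n v) = - (T m (T n v) - T n (T m v))" by simp
    then show ?thesis
      unfolding T_T_nonzero[OF False] using True False by simp
  qed (use True in simp)
qed (rule T_T_nonzero)

text \<open>The Feigin-Fuchs modification by a linear term. That term commutes with the modes up to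
  a scalar, so \<open>b\<close> tunes the central part of the bracket with \<open>a m\<close>; the
  value \<open>z2 / z3\<close> will match the action of \<open>Z2\<close>.\<close>

definition osc :: "complex \<Rightarrow> int \<Rightarrow> 'v \<Rightarrow> 'v" where
  "osc b k v = T k v + sc ((of_int k + 1) * b) (a k v)"

lemma osc_add: "osc b k (v + w) = osc b k v + osc b k w"
  by (simp add: osc_def T_add a_add scale_right_distrib)

lemma osc_scale: "osc b k (sc c v) = sc c (osc b k v)"
  by (simp add: osc_def T_scale a_scale scale_right_distrib mult.commute)

lemma osc_a:
  "osc b n (a m v) - a m (osc b n v) = sc (of_int m) (a (m + n) v)
     + sc (if n = - m then of_int (n ^ 2 + n) * b * z else 0) v"
proof -
  have "osc b n (a m v) - a m (osc b n v) = (T n (a m v) - a m (T n v))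
      + sc ((of_int n + 1) * b) (a n (a m v) - a m (a n v))"
    by (simp add: osc_def a_add a_scale algebra_simps)
  then show ?thesis
    unfolding T_a a_comm by (simp add: algebra_simps power2_eq_square)
qed

text \<open>The cross terms involve modes only. The two linear terms contribute
  \<open>n * (n + 1) * (1 - n) * b^2 * z\<close> at \<open>m = - n\<close>, which is again a
  multiple of \<open>n^3 - n\<close> and therefore just changes the central charge.\<close>

lemma osc_osc:
  "osc b n (osc b m v) - osc b m (osc b n v) = sc (of_int (m - n)) (osc b (m + n) v)
    + sc (if n = - m then of_int (n ^ 3 - n) / 12 * (1 - 12 * b ^ 2 * z) else 0) v"
proof -
  have "osc b n (osc b m v) - osc b m (osc b n v) =
     (T n (T m v) - T m (T n v))
     + sc ((of_int m + 1) * b) (T n (a m v) - a m (T n v))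
     - sc ((of_int n + 1) * b) (T m (a n v) - a n (T m v))
     + sc (((of_int n + 1) * b) * ((of_int m + 1) * b)) (a n (a m v) - a m (a n v))"
    by (simp add: osc_def T_add T_scale a_add a_scale scale_right_distrib scale_right_diff_distrib mult.commute algebra_simps)
  also have "\<dots> = sc (of_int (m - n)) (T (m + n) v)
     + sc ((of_int m + 1) * b * of_int m - (of_int n + 1) * b * of_int n) (a (m + n) v)
     + sc ((if n = - m then of_int (n ^ 3 - n) / 12 else 0)
       + ((of_int n + 1) * b) * ((of_int m + 1) * b) * (if n = - m then of_int n * z else 0)) v"
    unfolding T_T T_a a_comm
    by (simp add: scale_left_distrib scale_left_diff_distrib add_ac)
  also have "(of_int m + 1) * b * of_int m - (of_int n + 1) * b * of_int n
     = of_int (m - n) * ((of_int (m + n) + 1) * b)"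
    by (simp add: algebra_simps)
  also have "(if n = - m then of_int (n ^ 3 - n) / 12 else 0)
       + ((of_int n + 1) * b) * ((of_int m + 1) * b) * (if n = - m then of_int n * z else 0)
     = (if n = - m then of_int (n ^ 3 - n) / 12 * (1 - 12 * b ^ 2 * z) else 0)"
    by (simp add: field_simps power2_eq_square power3_eq_cube)
  finally show ?thesis
    by (simp add: osc_def scale_right_distrib)
qed

end

section \<open>Free tensors and normal forms\<close>

lemma vector_space_fsc: "vector_space (fsc :: complex \<Rightarrow> ('x \<Rightarrow> complex) \<Rightarrow> 'x \<Rightarrow> complex)"
  by unfold_locales (auto simp: fsc_def fun_eq_iff algebra_simps)

interpretation fs: vector_space "fsc :: complex \<Rightarrow> ('x \<Rightarrow> complex) \<Rightarrow> 'x \<Rightarrow> complex"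
  by (rule vector_space_fsc)

text \<open>Coordinates with respect to a Hamel basis. They move vectors into the function type in
  which the theorem asks for \<open>U\<close>.\<close>

lemma ex_coordinates:
  assumes "vector_space (sc :: complex \<Rightarrow> 'v::ab_group_add \<Rightarrow> 'v)"
  shows "\<exists>R :: 'v \<Rightarrow> 'v \<Rightarrow> complex. (\<forall>v w. R (v + w) = R v + R w) \<and> (\<forall>c v. R (sc c v) = fsc c (R v)) \<and> inj R"
proof -
  interpret vector_space sc by fact
  define B where "B = extend_basis {}"
  have B: "independent B"
    unfolding B_def by (rule independent_extend_basis[OF independent_empty])
  have "span B = UNIV"
    unfolding B_def by (rule span_extend_basis[OF independent_empty])
  then have sp: "v \<in> span B" for v by blast
  have "inj (representation B)"
  proof (rule injI)
    fix v w assume eq: "representation B v = representation B w"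
    have "(\<Sum>b | representation B v b \<noteq> 0. sc (representation B v b) b) = v"
      by (rule sum_nonzero_representation_eq[OF B sp])
    moreover have "(\<Sum>b | representation B w b \<noteq> 0. sc (representation B w b) b) = w"
      by (rule sum_nonzero_representation_eq[OF B sp])
    ultimately show "v = w" unfolding eq by (rule trans[OF sym])
  qed
  moreover have "representation B (v + w) = representation B v + representation B w" for v w
    using representation_add[OF B sp sp] by (intro ext) (simp only: plus_fun_apply)
  moreover have "representation B (sc c v) = fsc c (representation B v)" for c v
    using representation_scale[OF B sp] by (intro ext) (simp only: fsc_def)
  ultimately show ?thesis by blast
qed

text \<open>Linear extension of \<open>\<gamma>\<close> from point masses to finitely supported
  \<open>f\<close>. On infinite support the sum defaults to 0, hence the finiteness assumptions
  below.\<close>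

definition lext :: "(complex \<Rightarrow> 'v \<Rightarrow> 'v) \<Rightarrow> ('x \<Rightarrow> 'v) \<Rightarrow> ('x \<Rightarrow> complex) \<Rightarrow> 'v::ab_group_add" where
  "lext sc \<gamma> f = (\<Sum>p\<in>{p. f p \<noteq> 0}. sc (f p) (\<gamma> p))"

locale complex_space = vector_space sc
  for sc :: "complex \<Rightarrow> 'v::ab_group_add \<Rightarrow> 'v"
begin

lemma lext_eq: "finite A \<Longrightarrow> {p. f p \<noteq> 0} \<subseteq> A \<Longrightarrow> lext sc \<gamma> f = (\<Sum>p\<in>A. sc (f p) (\<gamma> p))"
  unfolding lext_def by (rule sum.mono_neutral_left) auto

lemma lext_zero: "lext sc \<gamma> 0 = 0"
  by (simp add: lext_def)

lemma lext_add:
  assumes "finite {p. f p \<noteq> 0}" "finite {p. g p \<noteq> 0}"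
  shows "lext sc \<gamma> (f + g) = lext sc \<gamma> f + lext sc \<gamma> g"
proof -
  let ?A = "{p. f p \<noteq> 0} \<union> {p. g p \<noteq> 0}"
  have A: "finite ?A" using assms by simp
  have "lext sc \<gamma> (f + g) = (\<Sum>p\<in>?A. sc ((f + g) p) (\<gamma> p))"
    by (rule lext_eq[OF A]) auto
  also have "\<dots> = (\<Sum>p\<in>?A. sc (f p) (\<gamma> p)) + (\<Sum>p\<in>?A. sc (g p) (\<gamma> p))"
    by (simp add: scale_left_distrib sum.distrib)
  also have "(\<Sum>p\<in>?A. sc (f p) (\<gamma> p)) = lext sc \<gamma> f"
    by (rule lext_eq[OF A, symmetric]) auto
  also have "(\<Sum>p\<in>?A. sc (g p) (\<gamma> p)) = lext sc \<gamma> g"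
    by (rule lext_eq[OF A, symmetric]) auto
  finally show ?thesis .
qed

lemma lext_fsc:
  assumes "finite {p. f p \<noteq> 0}"
  shows "lext sc \<gamma> (fsc c f) = sc c (lext sc \<gamma> f)"
proof -
  have "lext sc \<gamma> (fsc c f) = (\<Sum>p\<in>{p. f p \<noteq> 0}. sc (fsc c f p) (\<gamma> p))"
    by (rule lext_eq[OF assms]) (auto simp: fsc_def)
  also have "\<dots> = sc c (lext sc \<gamma> f)"
    unfolding lext_def scale_sum_right by (simp add: fsc_def)
  finally show ?thesis .
qed

lemma lext_pt: "lext sc \<gamma> (pt a b) = \<gamma> (a, b)"
proof -
  have "lext sc \<gamma> (pt a b) = (\<Sum>p\<in>{(a, b)}. sc (pt a b p) (\<gamma> p))"
    by (rule lext_eq) (auto simp: pt_def)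
  then show ?thesis by (simp add: pt_def)
qed

end

section \<open>Formal sums of pairs\<close>

lemma free_tens_subspace: "fs.subspace (free_tens A B)"
  unfolding fs.subspace_def
proof (intro conjI ballI allI)
  show "0 \<in> free_tens A B" by (simp add: free_tens_def)
next
  fix f g :: "'a \<times> 'b \<Rightarrow> complex" assume fg: "f \<in> free_tens A B" "g \<in> free_tens A B"
  have "{p. (f + g) p \<noteq> 0} \<subseteq> {p. f p \<noteq> 0} \<union> {p. g p \<noteq> 0}" by auto
  then show "f + g \<in> free_tens A B"
    using fg finite_subset unfolding free_tens_def by blast
next
  fix c and f :: "'a \<times> 'b \<Rightarrow> complex" assume f: "f \<in> free_tens A B"
  have "{p. fsc c f p \<noteq> 0} \<subseteq> {p. f p \<noteq> 0}" by (auto simp: fsc_def)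
  then show "fsc c f \<in> free_tens A B"
    using f finite_subset unfolding free_tens_def by blast
qed

lemma pt_free_tens: "a \<in> A \<Longrightarrow> b \<in> B \<Longrightarrow> pt a b \<in> free_tens A B"
proof -
  have "{p. pt a b p \<noteq> 0} = {(a, b)}" by (auto simp: pt_def)
  then show "a \<in> A \<Longrightarrow> b \<in> B \<Longrightarrow> pt a b \<in> free_tens A B"
    by (simp add: free_tens_def)
qed

lemma free_tens_finite: "f \<in> free_tens A B \<Longrightarrow> finite {p. f p \<noteq> 0}"
  by (simp add: free_tens_def)

lemma sum_fun_apply: "(\<Sum>p\<in>A. g p) q = (\<Sum>p\<in>A. g p q)"
  by (induction A rule: infinite_finite_induct) auto

lemma free_tens_expand:
  assumes "f \<in> free_tens A B"
  shows "f = (\<Sum>p\<in>{p. f p \<noteq> 0}. fsc (f p) (pt (fst p) (snd p)))"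
proof
  fix q
  have "(\<Sum>p\<in>{p. f p \<noteq> 0}. fsc (f p) (pt (fst p) (snd p))) q
      = (\<Sum>p\<in>{p. f p \<noteq> 0}. if p = q then f q else 0)"
    unfolding sum_fun_apply by (intro sum.cong refl) (auto simp: fsc_def pt_def)
  also have "\<dots> = f q"
    using free_tens_finite[OF assms] by simp
  finally show "f q = (\<Sum>p\<in>{p. f p \<noteq> 0}. fsc (f p) (pt (fst p) (snd p))) q" by simp
qed

lemma free_tens_span: "free_tens A B \<subseteq> fs.span {pt a b | a b. a \<in> A \<and> b \<in> B}"
proof
  fix f assume f: "f \<in> free_tens A B"
  have "(\<Sum>p\<in>{p. f p \<noteq> 0}. fsc (f p) (pt (fst p) (snd p))) \<in> fs.span {pt a b | a b. a \<in> A \<and> b \<in> B}"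
  proof (intro fs.span_sum fs.span_scale fs.span_base)
    fix p assume "p \<in> {p. f p \<noteq> 0}"
    then have "p \<in> A \<times> B" using f unfolding free_tens_def by blast
    then show "pt (fst p) (snd p) \<in> {pt a b | a b. a \<in> A \<and> b \<in> B}" by force
  qed
  then show "f \<in> fs.span {pt a b | a b. a \<in> A \<and> b \<in> B}"
    using free_tens_expand[OF f] by simp
qed

lemma tens_act_free_tens:
  assumes f: "f \<in> free_tens A B" and "\<And>a. a \<in> A \<Longrightarrow> \<rho>A g a \<in> A" "\<And>b. b \<in> B \<Longrightarrow> \<rho>B g b \<in> B"
  shows "tens_act \<rho>A \<rho>B g f \<in> free_tens A B"
  unfolding tens_act_def
proof (intro fs.subspace_sum free_tens_subspace fs.subspace_scale fs.subspace_add)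
  fix p assume "p \<in> {p. f p \<noteq> 0}"
  then have "p \<in> A \<times> B" using f unfolding free_tens_def by blast
  then show "pt (\<rho>A g (fst p)) (snd p) \<in> free_tens A B" "pt (fst p) (\<rho>B g (snd p)) \<in> free_tens A B"
    using assms by (auto intro!: pt_free_tens)
qed

text \<open>Bilinearity modulo \<open>N\<close> covers two situations at once: evaluation
  \<open>\<theta> u h\<close> in \<open>V\<close> with \<open>N = {0}\<close>, and point masses with
  \<open>N\<close> the span of the tensor relations. In both, elements are reduced to sums over
  distinct members of \<open>B\<close>.\<close>

locale bilinear_mod =
  V: vector_space sc + Hs: vector_space scH + Us: vector_space scU
  for sc :: "complex \<Rightarrow> 'v::ab_group_add \<Rightarrow> 'v"
    and scH :: "complex \<Rightarrow> 'h::ab_group_add \<Rightarrow> 'h"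
    and scU :: "complex \<Rightarrow> 'u::ab_group_add \<Rightarrow> 'u" +
  fixes N H B and \<beta> :: "'h \<Rightarrow> 'u \<Rightarrow> 'v"
  assumes N: "V.subspace N" and H: "Hs.subspace H"
    and add_l: "h \<in> H \<Longrightarrow> h' \<in> H \<Longrightarrow> u \<in> Us.span B \<Longrightarrow> \<beta> (h + h') u - \<beta> h u - \<beta> h' u \<in> N"
    and add_r: "h \<in> H \<Longrightarrow> u \<in> Us.span B \<Longrightarrow> u' \<in> Us.span B \<Longrightarrow> \<beta> h (u + u') - \<beta> h u - \<beta> h u' \<in> N"
    and scale_l: "h \<in> H \<Longrightarrow> u \<in> Us.span B \<Longrightarrow> \<beta> (scH c h) u - sc c (\<beta> h u) \<in> N"
    and scale_r: "h \<in> H \<Longrightarrow> u \<in> Us.span B \<Longrightarrow> \<beta> h (scU c u) - sc c (\<beta> h u) \<in> N"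
begin

definition normal :: "'v \<Rightarrow> bool" where
  "normal x \<longleftrightarrow> (\<exists>F k. finite F \<and> F \<subseteq> B \<and> (\<forall>b. k b \<in> H) \<and> x - (\<Sum>b\<in>F. \<beta> (k b) b) \<in> N)"

lemma zero_l: "u \<in> Us.span B \<Longrightarrow> \<beta> 0 u \<in> N"
  using scale_l[of 0 u 0] H by (simp add: Hs.subspace_0)

lemma zero_r: "h \<in> H \<Longrightarrow> \<beta> h 0 \<in> N"
  using scale_r[of h 0 0] by (simp add: Us.span_zero)

lemma normal_cong:
  assumes "normal y" "x - y \<in> N"
  shows "normal x"
proof -
  obtain F k where F: "finite F" "F \<subseteq> B" "\<forall>b. k b \<in> H" "y - (\<Sum>b\<in>F. \<beta> (k b) b) \<in> N"
    using assms(1) unfolding normal_def by blast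
  have "x - (\<Sum>b\<in>F. \<beta> (k b) b) \<in> N"
    using V.subspace_add[OF N assms(2) F(4)] by simp
  then show ?thesis unfolding normal_def using F by blast
qed

lemma normal_add:
  assumes "normal x" "normal y"
  shows "normal (x + y)"
proof -
  obtain F k where F: "finite F" "F \<subseteq> B" "\<forall>b. k b \<in> H" "x - (\<Sum>b\<in>F. \<beta> (k b) b) \<in> N"
    using assms(1) unfolding normal_def by blast
  obtain G l where G: "finite G" "G \<subseteq> B" "\<forall>b. l b \<in> H" "y - (\<Sum>b\<in>G. \<beta> (l b) b) \<in> N"
    using assms(2) unfolding normal_def by blast
  \<comment> \<open>Coefficients at a common \<open>b\<close> are merged; by additivity in the left
    argument this changes the sum only by an element of \<open>N\<close>.\<close>
  define m where "m b = (if b \<in> F then k b else 0) + (if b \<in> G then l b else 0)" for b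
  have m: "\<forall>b. m b \<in> H"
    using F G H by (auto simp: m_def Hs.subspace_add Hs.subspace_0)
  have "(if b \<in> F then \<beta> (k b) b else 0) + (if b \<in> G then \<beta> (l b) b else 0) - \<beta> (m b) b \<in> N"
    if "b \<in> F \<union> G" for b
  proof -
    have b: "b \<in> Us.span B" using that F G by (auto intro: Us.span_base)
    have "\<beta> (k b + l b) b - \<beta> (k b) b - \<beta> (l b) b \<in> N"
      using add_l[of "k b" "l b" b] F G b by simp
    from V.subspace_neg[OF N this]
    have "\<beta> (k b) b + \<beta> (l b) b - \<beta> (k b + l b) b \<in> N"
      by (simp add: algebra_simps)
    then show ?thesis
      using that V.subspace_0[OF N] by (cases "b \<in> F"; cases "b \<in> G") (simp_all add: m_def)
  qed
  then have "(\<Sum>b\<in>F \<union> G. (if b \<in> F then \<beta> (k b) b else 0) + (if b \<in> G then \<beta> (l b) b else 0) - \<beta> (m b) b) \<in> N"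
    using N by (intro V.subspace_sum) auto
  moreover have "(\<Sum>b\<in>F \<union> G. if b \<in> F then \<beta> (k b) b else 0) = (\<Sum>b\<in>F. \<beta> (k b) b)"
    using F G by (intro sum.mono_neutral_cong_right) auto
  moreover have "(\<Sum>b\<in>F \<union> G. if b \<in> G then \<beta> (l b) b else 0) = (\<Sum>b\<in>G. \<beta> (l b) b)"
    using F G by (intro sum.mono_neutral_cong_right) auto
  ultimately have "(\<Sum>b\<in>F. \<beta> (k b) b) + (\<Sum>b\<in>G. \<beta> (l b) b) - (\<Sum>b\<in>F \<union> G. \<beta> (m b) b) \<in> N"
    by (simp add: sum.distrib sum_subtractf)
  from V.subspace_add[OF N this V.subspace_add[OF N F(4) G(4)]]
  have "x + y - (\<Sum>b\<in>F \<union> G. \<beta> (m b) b) \<in> N"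
    by (simp add: algebra_simps)
  then show ?thesis
    unfolding normal_def using F G m by (intro exI[of _ "F \<union> G"] exI[of _ m]) auto
qed

lemma normal_scale:
  assumes "normal x"
  shows "normal (sc c x)"
proof -
  obtain F k where F: "finite F" "F \<subseteq> B" "\<forall>b. k b \<in> H" "x - (\<Sum>b\<in>F. \<beta> (k b) b) \<in> N"
    using assms(1) unfolding normal_def by blast
  have "(\<Sum>b\<in>F. \<beta> (scH c (k b)) b - sc c (\<beta> (k b) b)) \<in> N"
    using N F by (intro V.subspace_sum scale_l) (auto intro: Us.span_base)
  from V.subspace_diff[OF N V.subspace_scale[OF N F(4), of c] this]
  have "sc c x - (\<Sum>b\<in>F. \<beta> (scH c (k b)) b) \<in> N"
    by (simp add: V.scale_right_diff_distrib V.scale_sum_right sum_subtractf)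
  then show ?thesis
    unfolding normal_def using F H
    by (intro exI[of _ F] exI[of _ "\<lambda>b. scH c (k b)"]) (auto simp: Hs.subspace_scale)
qed

lemma normal_zero: "normal 0"
  unfolding normal_def using H N
  by (intro exI[of _ "{}"] exI[of _ "\<lambda>_. 0"]) (auto simp: V.subspace_0 Hs.subspace_0)

lemma normal_gen:
  assumes "h \<in> H" "u \<in> Us.span B"
  shows "normal (\<beta> h u)"
proof -
  have "u \<in> Us.span B \<and> normal (\<beta> h u)"
    using assms(2)
  proof (induction rule: Us.span_induct_alt)
    case base
    have "normal (\<beta> h 0)"
      by (rule normal_cong[OF normal_zero]) (simp add: assms zero_r)
    then show ?case by (simp add: Us.span_zero)
  next
    case (step c b y)
    have b: "b \<in> Us.span B" "scU c b \<in> Us.span B"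
      using step by (auto intro: Us.span_base Us.span_scale)
    have "normal (\<beta> h b)"
      unfolding normal_def using step assms H N
      by (intro exI[of _ "{b}"] exI[of _ "\<lambda>_. h"]) (auto simp: V.subspace_0)
    then have "normal (\<beta> h (scU c b))"
      using normal_scale normal_cong scale_r[OF assms(1) b(1)] by blast
    then have "normal (\<beta> h (scU c b) + \<beta> h y)"
      using step normal_add by blast
    then have "normal (\<beta> h (scU c b + y))"
      by (rule normal_cong) (use add_r[OF assms(1) b(2)] step in \<open>simp add: algebra_simps\<close>)
    then show ?case using b step by (simp add: Us.span_add)
  qed
  then show ?thesis by simp
qed

lemma normal_span:
  assumes "x \<in> V.span {\<beta> h u | h u. h \<in> H \<and> u \<in> Us.span B}"
  shows "normal x"
  using assms
  by (induction rule: V.span_induct_alt) (auto intro: normal_zero normal_add normal_scale normal_gen)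

end

section \<open>The multiplicity space of a Heisenberg submodule\<close>

lemma sum_br_D_D:
  assumes "vector_space sc"
  shows "(\<Sum>g\<in>{g. br (D n) (D m) g \<noteq> 0}. sc (br (D n) (D m) g) (F g)) =
    sc (of_int (m - n)) (F (D (m + n))) + sc (if n = - m then of_int (n ^ 3 - n) / 12 else 0) (F Z1)"
proof -
  interpret vector_space sc by fact
  have "(\<Sum>g\<in>{g. br (D n) (D m) g \<noteq> 0}. sc (br (D n) (D m) g) (F g)) =
      (\<Sum>g\<in>{D (m + n), Z1}. sc (br (D n) (D m) g) (F g))"
    by (rule sum.mono_neutral_left) (auto split: if_splits)
  then show ?thesis by simp
qed

lemma sum_br_D_I:
  assumes "vector_space sc"
  shows "(\<Sum>g\<in>{g. br (D n) (I m) g \<noteq> 0}. sc (br (D n) (I m) g) (F g)) =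
    sc (of_int m) (F (I (m + n))) + sc (if n = - m then of_int (n ^ 2 + n) else 0) (F Z2)"
proof -
  interpret vector_space sc by fact
  have "(\<Sum>g\<in>{g. br (D n) (I m) g \<noteq> 0}. sc (br (D n) (I m) g) (F g)) =
      (\<Sum>g\<in>{I (m + n), Z2}. sc (br (D n) (I m) g) (F g))"
    by (rule sum.mono_neutral_left) (auto split: if_splits)
  then show ?thesis by simp
qed

lemma sum_br_I_I:
  assumes "vector_space sc"
  shows "(\<Sum>g\<in>{g. br (I n) (I m) g \<noteq> 0}. sc (br (I n) (I m) g) (F g)) =
    sc (if n = - m then of_int n else 0) (F Z3)"
proof -
  interpret vector_space sc by fact
  have "(\<Sum>g\<in>{g. br (I n) (I m) g \<noteq> 0}. sc (br (I n) (I m) g) (F g)) =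
      (\<Sum>g\<in>{Z3}. sc (br (I n) (I m) g) (F g))"
    by (rule sum.mono_neutral_left) (auto split: if_splits)
  then show ?thesis by simp
qed

lemma br_central: "c \<in> {Z1, Z2, Z3} \<Longrightarrow> br c x = (\<lambda>_. 0)" "c \<in> {Z1, Z2, Z3} \<Longrightarrow> br x c = (\<lambda>_. 0)"
  by (cases x; fastforce)+

text \<open>A central generator is itself an endomorphism of the module, so Schur's lemma applies to
  it.\<close>

lemma central_scalar:
  assumes V: "vector_space sc" and simple: "simple_rep Lgens sc UNIV \<rho>" and c: "c \<in> {Z1, Z2, Z3}"
  shows "\<exists>d. \<forall>v. \<rho> c v = sc d v"
proof -
  interpret vector_space sc by fact
  interpret module_endo sc Lgens UNIV \<rho> "\<rho> c"
  proof
    fix v w d g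
    show "\<rho> c (v + w) = \<rho> c v + \<rho> c w" "\<rho> c (sc d v) = sc d (\<rho> c v)"
      using simple_rep_add[OF simple] simple_rep_scale[OF simple] by (auto simp: Lgens_def)
    show "\<rho> c (\<rho> g v) = \<rho> g (\<rho> c v)"
      using simple_rep_bracket[OF simple, of c g v] c by (simp add: Lgens_def br_central)
  qed (auto intro: simple)
  show ?thesis using endo_scalar by simp
qed

text \<open>The scalars \<open>z2\<close>, \<open>z3\<close> are supplied by
  \<open>central_scalar\<close>. The coordinates \<open>R\<close> and the vector \<open>h0\<close>
  are arbitrary choices, fixed once to encode homomorphisms.\<close>

locale heisenberg_submodule = complex_space sV
  for sV :: "complex \<Rightarrow> 'v::ab_group_add \<Rightarrow> 'v" +
  fixes \<rho> :: "Lgen \<Rightarrow> 'v \<Rightarrow> 'v" and H :: "'v set" and z2 z3 :: complex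
    and R :: "'v \<Rightarrow> 'v \<Rightarrow> complex" and h0 :: 'v
  assumes simpleV: "simple_rep Lgens sV UNIV \<rho>"
    and inO: "in_O Lgens UNIV \<rho>"
    and simpleH: "simple_rep Hgens sV H \<rho>"
    and Z2: "\<rho> Z2 v = sV z2 v" and Z3: "\<rho> Z3 v = sV z3 v" and z3: "z3 \<noteq> 0"
    and R_add: "R (v + w) = R v + R w" and R_scale: "R (sV c v) = fsc c (R v)" and R_inj: "inj R"
    and h0: "h0 \<in> H" "h0 \<noteq> 0"
begin

lemma \<rho>_add: "\<rho> g (v + w) = \<rho> g v + \<rho> g w"
  using simple_rep_add[OF simpleV, of g v w] by (simp add: Lgens_def)

lemma \<rho>_scale: "\<rho> g (sV c v) = sV c (\<rho> g v)"
  using simple_rep_scale[OF simpleV, of g v c] by (simp add: Lgens_def)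

lemma \<rho>_bracket: "\<rho> x (\<rho> y v) - \<rho> y (\<rho> x v) = (\<Sum>g\<in>{g. br x y g \<noteq> 0}. sV (br x y g) (\<rho> g v))"
  using simple_rep_bracket[OF simpleV, of x y v] by (simp add: Lgens_def)

abbreviation a :: "int \<Rightarrow> 'v \<Rightarrow> 'v" where "a n \<equiv> \<rho> (I n)"

sublocale heisenberg sV a z3
proof
  fix n m v w c
  show "a n (v + w) = a n v + a n w" "a n (sV c v) = sV c (a n v)" by (rule \<rho>_add \<rho>_scale)+
  show "a n (a m v) - a m (a n v) = (if n = - m then sV (of_int n * z3) v else 0)"
    unfolding \<rho>_bracket sum_br_I_I[OF vector_space_axioms] by (simp add: Z3)
  show "z3 \<noteq> 0" by (rule z3)
  show "\<exists>N. \<forall>n\<ge>N. a n v = 0"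
    using inO unfolding in_O_def Lgens_def by (metis UNIV_I deg.simps(2))
qed

section \<open>The oscillator action on \<open>V\<close> and its complement\<close>

abbreviation Hm :: "Lgen \<Rightarrow> 'v \<Rightarrow> 'v" where "Hm \<equiv> Hmod sV a z2 z3"

lemma Hm_D: "Hm (D k) v = osc (z2 / z3) k v"
  by (simp add: osc_def T_def)

lemma Hm_add: "Hm g (v + w) = Hm g v + Hm g w"
  by (cases g) (simp_all add: Hm_D osc_add a_add scale_right_distrib del: Hmod.simps(5))

lemma Hm_scale: "Hm g (sV c v) = sV c (Hm g v)"
  by (cases g) (simp_all add: Hm_D osc_scale a_scale mult.commute del: Hmod.simps(5))

lemma Hm_bracket:
  assumes "x \<in> Virgens" "y \<in> Virgens"
  shows "Hm x (Hm y v) - Hm y (Hm x v) = (\<Sum>g\<in>{g. br x y g \<noteq> 0}. sV (br x y g) (Hm g v))"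
proof (cases "x = Z1 \<or> y = Z1")
  case True
  then show ?thesis by (auto simp: br_central Hm_scale)
next
  case False
  then obtain n m where xy: "x = D n" "y = D m" using assms by (auto simp: Virgens_def)
  show ?thesis
    unfolding xy sum_br_D_D[OF vector_space_axioms] Hm_D osc_osc
    using z3 by (simp add: power_divide power2_eq_square)
qed

text \<open>These operators commute with the Heisenberg algebra and carry the Virasoro factor \<open>U\<close>.\<close>

definition bar :: "Lgen \<Rightarrow> 'v \<Rightarrow> 'v" where
  "bar g v = \<rho> g v - Hm g v"

lemma bar_trivial: "bar (I n) v = 0" "bar Z2 v = 0" "bar Z3 v = 0"
  by (simp_all add: bar_def Z2 Z3)

lemma bar_add: "bar g (v + w) = bar g v + bar g w"
  by (simp add: bar_def \<rho>_add Hm_add)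

lemma bar_scale: "bar g (sV c v) = sV c (bar g v)"
  by (simp add: bar_def \<rho>_scale Hm_scale scale_right_diff_distrib)

lemma bar_zero: "bar g 0 = 0"
  using bar_scale[of g 0 0] by simp

lemma bar_diff: "bar g (v - w) = bar g v - bar g w"
  using bar_add[of g "v - w" w] by (simp add: algebra_simps)

text \<open>For \<open>d_n\<close> the two commutators with \<open>a m\<close> agree by
  \<open>osc_a\<close>, because \<open>(z2 / z3) * z3 = z2\<close>.\<close>

lemma bar_a: "bar g (a m v) = a m (bar g v)"
proof (cases "g \<in> {Z1, Z2, Z3}")
  case True
  then have "\<rho> g (a m v) = a m (\<rho> g v)"
    using \<rho>_bracket[of g "I m" v] by (simp add: br_central)
  then show ?thesis using True by (auto simp: bar_def a_minus a_scale)
next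
  case False
  show ?thesis
  proof (cases g)
    case (D n)
    have "\<rho> g (a m v) - a m (\<rho> g v) = Hm g (a m v) - a m (Hm g v)"
      unfolding D \<rho>_bracket sum_br_D_I[OF vector_space_axioms] Hm_D osc_a
      using z3 by (simp add: Z2)
    then show ?thesis by (simp add: bar_def a_minus algebra_simps)
  qed (use False in \<open>auto simp: bar_trivial a_zero\<close>)
qed

text \<open>\<open>sug\<close> is a locally finite sum of products of modes, so whatever respects
  the modes respects it. A cutoff for \<open>v\<close> also serves for \<open>f v\<close>, since
  \<open>f\<close> commutes with each summand.\<close>

lemma sug_intertwine:
  assumes C: "subspace C" "\<And>n v. v \<in> C \<Longrightarrow> a n v \<in> C"
    and f: "\<And>v w. v \<in> C \<Longrightarrow> w \<in> C \<Longrightarrow> f (v + w) = f v + f w"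
      "\<And>n v. v \<in> C \<Longrightarrow> f (a n v) = a n (f v)"
    and v: "v \<in> C"
  shows "f (sug a k v) = sug a k (f v)" "sug a k v \<in> C"
proof -
  have f0: "f 0 = 0" using f(1)[of 0 0] C by (simp add: subspace_0)
  have n: "nord a k i v \<in> C" for i using C(2) v by (simp add: nord_def)
  have fn: "f (nord a k i v) = nord a k i (f v)" for i
    using C(2) v by (simp add: nord_def f)
  have fs: "f (\<Sum>i\<in>A. nord a k i v) = (\<Sum>i\<in>A. nord a k i (f v))" if "finite A" for A
    using that
  proof induction
    case (insert x A)
    then show ?case using n C by (simp add: f fn subspace_sum)
  qed (simp add: f0)
  obtain N where N: "\<forall>i. N < \<bar>i\<bar> \<longrightarrow> nord a k i v = 0" using nord_cutoff by blast
  then have "\<forall>i. N < \<bar>i\<bar> \<longrightarrow> nord a k i (f v) = 0" using fn f0 by metis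
  with N show "f (sug a k v) = sug a k (f v)" by (simp add: sug_interval fs)
  show "sug a k v \<in> C" using N C n by (simp add: sug_interval subspace_sum)
qed

lemma Hm_intertwine:
  assumes C: "subspace C" "\<And>n v. v \<in> C \<Longrightarrow> a n v \<in> C"
    and f: "\<And>v w. v \<in> C \<Longrightarrow> w \<in> C \<Longrightarrow> f (v + w) = f v + f w"
      "\<And>c v. v \<in> C \<Longrightarrow> f (sV c v) = sV c (f v)"
      "\<And>n v. v \<in> C \<Longrightarrow> f (a n v) = a n (f v)"
    and v: "v \<in> C"
  shows "f (Hm g v) = Hm g (f v)" "Hm g v \<in> C"
proof -
  have "f (Hm g v) = Hm g (f v) \<and> Hm g v \<in> C"
  proof (cases g)
    case (D k)
    have "f (sug a k v) = sug a k (f v)" "sug a k v \<in> C"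
      using sug_intertwine[of C f v k] assms by auto
    then show ?thesis
      unfolding D Hmod.simps using C v f by (simp only: f subspace_scale subspace_add)
  qed (use C v f in \<open>auto simp: subspace_scale\<close>)
  then show "f (Hm g v) = Hm g (f v)" "Hm g v \<in> C" by auto
qed

lemma bar_Hm: "bar g (Hm g' v) = Hm g' (bar g v)"
  by (rule Hm_intertwine(1)[of UNIV]) (auto simp: bar_add bar_scale bar_a)

text \<open>The coset construction: \<open>\<rho> = Hm + bar\<close>, and the summands commute by
  \<open>bar_Hm\<close>. Hence the commutator of the \<open>bar\<close> operators is that of
  \<open>\<rho>\<close> minus that of \<open>Hm\<close>, and both satisfy the same
  relations.\<close>

lemma bar_bracket:
  assumes "x \<in> Virgens" "y \<in> Virgens"
  shows "bar x (bar y v) - bar y (bar x v) = (\<Sum>g\<in>{g. br x y g \<noteq> 0}. sV (br x y g) (bar g v))"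
proof -
  have "bar y (Hm x v) = Hm x (\<rho> y v) - Hm x (Hm y v)"
    using Hm_add[of x "\<rho> y v - Hm y v" "Hm y v"] by (simp add: bar_Hm bar_def[of y v])
  then have 1: "\<rho> y (Hm x v) = Hm y (Hm x v) + (Hm x (\<rho> y v) - Hm x (Hm y v))"
    unfolding bar_def[of y] by (simp add: algebra_simps)
  have 2: "\<rho> y (bar x v) = \<rho> y (\<rho> x v) - \<rho> y (Hm x v)"
    using \<rho>_add[of y "\<rho> x v - Hm x v" "Hm x v"] by (simp add: bar_def[of x])
  have 3: "bar x (bar y v) = bar x (\<rho> y v) - Hm y (bar x v)"
    unfolding bar_def[of y] bar_diff bar_Hm ..
  have "bar x (bar y v) - bar y (bar x v) = bar x (\<rho> y v) - \<rho> y (bar x v)"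
    unfolding 3 bar_def[of y "bar x v"] by simp
  also have "\<dots> = (\<rho> x (\<rho> y v) - \<rho> y (\<rho> x v)) - (Hm x (Hm y v) - Hm y (Hm x v))"
    unfolding 2 1 bar_def[of x "\<rho> y v"] by (simp add: algebra_simps)
  finally show ?thesis
    unfolding \<rho>_bracket Hm_bracket[OF assms] bar_def
    by (simp add: scale_right_diff_distrib sum_subtractf)
qed

section \<open>Homomorphisms from \<open>H\<close> to \<open>V\<close>\<close>

lemmas subspaceH = simple_rep_subspace[OF simpleH]

lemma a_H: "x \<in> H \<Longrightarrow> a n x \<in> H"
  using simple_rep_closed[OF simpleH, of "I n"] by (simp add: Hgens_def)

lemma H_submodule:
  assumes "subspace W" "W \<subseteq> H" "\<And>n w. w \<in> W \<Longrightarrow> a n w \<in> W"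
  shows "W = {0} \<or> W = H"
  using assms by (intro simple_rep_submodule[OF simpleH]) (auto simp: Hgens_def Z3 subspace_scale)

lemma H_endo:
  assumes "\<And>x. x \<in> H \<Longrightarrow> f x \<in> H" "\<And>x y. x \<in> H \<Longrightarrow> y \<in> H \<Longrightarrow> f (x + y) = f x + f y"
    and "\<And>c x. x \<in> H \<Longrightarrow> f (sV c x) = sV c (f x)" "\<And>n x. x \<in> H \<Longrightarrow> f (a n x) = a n (f x)"
  shows "\<exists>c. \<forall>x\<in>H. f x = sV c x"
proof -
  interpret module_endo sV Hgens H \<rho> f
    by unfold_locales (use assms simpleH in \<open>auto simp: Hgens_def Z3\<close>)
  show ?thesis by (rule endo_scalar)
qed

text \<open>The value 0 outside \<open>H\<close> makes homomorphisms that agree on \<open>H\<close>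
  equal as functions.\<close>

definition Homs :: "('v \<Rightarrow> 'v) set" where
  "Homs = {f. (\<forall>x\<in>H. \<forall>y\<in>H. f (x + y) = f x + f y) \<and> (\<forall>x\<in>H. \<forall>c. f (sV c x) = sV c (f x))
     \<and> (\<forall>x\<in>H. \<forall>n. f (a n x) = a n (f x)) \<and> (\<forall>x. x \<notin> H \<longrightarrow> f x = 0)}"

lemma Hom_add: "f \<in> Homs \<Longrightarrow> x \<in> H \<Longrightarrow> y \<in> H \<Longrightarrow> f (x + y) = f x + f y"
  and Hom_scale: "f \<in> Homs \<Longrightarrow> x \<in> H \<Longrightarrow> f (sV c x) = sV c (f x)"
  and Hom_a: "f \<in> Homs \<Longrightarrow> x \<in> H \<Longrightarrow> f (a n x) = a n (f x)"
  and Hom_outside: "f \<in> Homs \<Longrightarrow> x \<notin> H \<Longrightarrow> f x = 0"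
  by (auto simp: Homs_def)

lemma Hom_zero: "f \<in> Homs \<Longrightarrow> f 0 = 0"
  using Hom_scale[of f h0 0] h0 by simp

lemma Hm_H: "x \<in> H \<Longrightarrow> Hm g x \<in> H"
  by (rule Hm_intertwine(2)[where f = "\<lambda>v. v"]) (auto simp: subspaceH a_H)

lemma Hom_Hm: "f \<in> Homs \<Longrightarrow> x \<in> H \<Longrightarrow> f (Hm g x) = Hm g (f x)"
  by (rule Hm_intertwine(1)[of H]) (auto simp: subspaceH a_H Hom_add Hom_scale Hom_a)

lemma Homs_add: "f \<in> Homs \<Longrightarrow> g \<in> Homs \<Longrightarrow> (\<lambda>x. f x + g x) \<in> Homs"
  by (auto simp: Homs_def a_add scale_right_distrib)

lemma Homs_scale: "f \<in> Homs \<Longrightarrow> (\<lambda>x. sV c (f x)) \<in> Homs"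
  by (auto simp: Homs_def a_scale scale_right_distrib mult.commute)

lemma Homs_bar: "f \<in> Homs \<Longrightarrow> (\<lambda>x. bar g (f x)) \<in> Homs"
  by (auto simp: Homs_def bar_a bar_add bar_scale bar_zero)

lemma Homs_zero: "(\<lambda>x. 0) \<in> Homs"
  by (auto simp: Homs_def a_zero)

text \<open>The equalizer of \<open>f\<close> and \<open>g\<close> is a submodule of
  \<open>H\<close> containing \<open>h0 \<noteq> 0\<close>. So evaluation at \<open>h0\<close> loses
  no information, which justifies the encoding of \<open>U\<close>.\<close>

lemma Hom_eqI:
  assumes f: "f \<in> Homs" "g \<in> Homs" "f h0 = g h0"
  shows "f = g"
proof
  fix x
  have "{x \<in> H. f x = g x} = {0} \<or> {x \<in> H. f x = g x} = H"
    using f subspaceH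
    by (intro H_submodule) (auto simp: subspace_def Hom_zero Hom_add Hom_scale Hom_a a_H)
  then have "{x \<in> H. f x = g x} = H" using f h0 by blast
  then show "f x = g x" using Hom_outside[OF f(1)] Hom_outside[OF f(2)] by (cases "x \<in> H") auto
qed

lemma R_zero: "R 0 = 0"
  using R_add[of 0 0] by simp

lemma R_eq_iff: "R v = R w \<longleftrightarrow> v = w"
  using R_inj by (auto dest: injD)

lemma R_diff: "R (v - w) = R v - R w"
  using R_add[of "v - w" w] by (simp add: algebra_simps)

lemma R_sum: "R (\<Sum>i\<in>A. f i) = (\<Sum>i\<in>A. R (f i))"
  by (induction A rule: infinite_finite_induct) (simp_all add: R_zero R_add)

text \<open>The multiplicity space \<open>Hom(H, V)\<close>, realised as a set of functions by evaluating at \<open>h0\<close> and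
  taking coordinates.\<close>

definition U :: "('v \<Rightarrow> complex) set" where
  "U = (\<lambda>f. R (f h0)) ` Homs"

definition \<theta> :: "('v \<Rightarrow> complex) \<Rightarrow> 'v \<Rightarrow> 'v" where
  "\<theta> u = (THE f. f \<in> Homs \<and> R (f h0) = u)"

definition \<rho>U :: "Lgen \<Rightarrow> ('v \<Rightarrow> complex) \<Rightarrow> 'v \<Rightarrow> complex" where
  "\<rho>U g u = R (bar g (\<theta> u h0))"

lemma \<theta>_R: "f \<in> Homs \<Longrightarrow> \<theta> (R (f h0)) = f"
  unfolding \<theta>_def by (rule the_equality) (auto simp: R_eq_iff intro: Hom_eqI)

lemma R_Homs: "f \<in> Homs \<Longrightarrow> R (f h0) \<in> U"
  by (simp add: U_def)

lemma \<theta>_Homs: "u \<in> U \<Longrightarrow> \<theta> u \<in> Homs" and R_\<theta>: "u \<in> U \<Longrightarrow> R (\<theta> u h0) = u"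
  by (auto simp: U_def \<theta>_R)

lemma U_add: "u \<in> U \<Longrightarrow> w \<in> U \<Longrightarrow> u + w \<in> U"
  and \<theta>_add: "u \<in> U \<Longrightarrow> w \<in> U \<Longrightarrow> \<theta> (u + w) x = \<theta> u x + \<theta> w x"
proof -
  assume u: "u \<in> U" "w \<in> U"
  let ?f = "\<lambda>x. \<theta> u x + \<theta> w x"
  have f: "?f \<in> Homs" using u by (intro Homs_add \<theta>_Homs)
  have R: "R (?f h0) = u + w" using u by (simp only: R_add R_\<theta>)
  show "u + w \<in> U" "\<theta> (u + w) x = \<theta> u x + \<theta> w x"
    using \<theta>_R[OF f] R_Homs[OF f] unfolding R by simp_all
qed

lemma U_scale: "u \<in> U \<Longrightarrow> fsc c u \<in> U"
  and \<theta>_scale: "u \<in> U \<Longrightarrow> \<theta> (fsc c u) x = sV c (\<theta> u x)"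
proof -
  assume u: "u \<in> U"
  let ?f = "\<lambda>x. sV c (\<theta> u x)"
  have f: "?f \<in> Homs" using u by (intro Homs_scale \<theta>_Homs)
  have R: "R (?f h0) = fsc c u" using u by (simp only: R_scale R_\<theta>)
  show "fsc c u \<in> U" "\<theta> (fsc c u) x = sV c (\<theta> u x)"
    using \<theta>_R[OF f] R_Homs[OF f] unfolding R by simp_all
qed

lemma U_zero: "0 \<in> U" and \<theta>_zero: "\<theta> 0 x = 0"
  using R_Homs[OF Homs_zero] \<theta>_R[OF Homs_zero] by (simp_all add: R_zero)

lemma subspaceU: "fs.subspace U"
  by (simp add: fs.subspace_def U_zero U_add U_scale)

lemma \<rho>U_closed: "u \<in> U \<Longrightarrow> \<rho>U g u \<in> U"
  and \<theta>_\<rho>U: "u \<in> U \<Longrightarrow> \<theta> (\<rho>U g u) x = bar g (\<theta> u x)"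
  using R_Homs[OF Homs_bar[OF \<theta>_Homs, of u g]] \<theta>_R[OF Homs_bar[OF \<theta>_Homs, of u g]]
  by (simp_all add: \<rho>U_def)

lemma \<theta>_Hadd: "u \<in> U \<Longrightarrow> x \<in> H \<Longrightarrow> y \<in> H \<Longrightarrow> \<theta> u (x + y) = \<theta> u x + \<theta> u y"
  and \<theta>_Hscale: "u \<in> U \<Longrightarrow> x \<in> H \<Longrightarrow> \<theta> u (sV c x) = sV c (\<theta> u x)"
  and \<theta>_Ha: "u \<in> U \<Longrightarrow> x \<in> H \<Longrightarrow> \<theta> u (a n x) = a n (\<theta> u x)"
  and \<theta>_H0: "u \<in> U \<Longrightarrow> \<theta> u 0 = 0"
  using \<theta>_Homs by (auto simp: Hom_add Hom_scale Hom_a Hom_zero)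

lemma \<theta>_Hdiff: "u \<in> U \<Longrightarrow> x \<in> H \<Longrightarrow> y \<in> H \<Longrightarrow> \<theta> u (x - y) = \<theta> u x - \<theta> u y"
  using \<theta>_Hadd[of u "x - y" y] subspaceH by (simp add: subspace_diff algebra_simps)

text \<open>If the last summand met the span of the others, simplicity of \<open>H\<close> would express it through
  endomorphisms of \<open>H\<close>, which are scalars, contradicting independence.\<close>

lemma independent_isotypic:
  assumes "finite F" "F \<subseteq> U" "fs.independent F" "\<And>b. b \<in> F \<Longrightarrow> h b \<in> H"
    and "(\<Sum>b\<in>F. \<theta> b (h b)) = 0" "b \<in> F"
  shows "h b = 0"
  using assms
proof (induction F arbitrary: h b rule: finite_induct)
  case (insert u F)
  have u: "u \<in> U" and F: "F \<subseteq> U" using insert by auto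
  have indF: "fs.independent F" and uF: "u \<notin> fs.span F"
    using insert by (auto simp: fs.independent_insert)
  \<comment> \<open>The induction hypothesis, applied to differences, makes the coefficients of a
    sum over \<open>F\<close> unique.\<close>
  have uniq: "k b = l b"
    if "\<And>b. b \<in> F \<Longrightarrow> k b \<in> H" "\<And>b. b \<in> F \<Longrightarrow> l b \<in> H"
      "(\<Sum>b\<in>F. \<theta> b (k b)) = (\<Sum>b\<in>F. \<theta> b (l b))" "b \<in> F" for k l b
  proof -
    have "(\<Sum>b\<in>F. \<theta> b (k b - l b)) = (\<Sum>b\<in>F. \<theta> b (k b) - \<theta> b (l b))"
      using that F by (intro sum.cong refl \<theta>_Hdiff) auto
    then have "(\<Sum>b\<in>F. \<theta> b (k b - l b)) = 0"
      using that by (simp add: sum_subtractf)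
    then have "k b - l b = 0"
      using insert.IH[OF F indF, of "\<lambda>b. k b - l b" b] that subspaceH by (auto simp: subspace_diff)
    then show ?thesis by simp
  qed
  \<comment> \<open>The part of \<open>H\<close> that \<open>\<theta> u\<close> sends into the sum
    of the other images; it is a submodule, hence zero or everything.\<close>
  define K where "K = {x \<in> H. \<exists>k. (\<forall>b\<in>F. k b \<in> H) \<and> \<theta> u x = (\<Sum>b\<in>F. \<theta> b (k b))}"
  have "K = {0} \<or> K = H"
  proof (rule H_submodule)
    show "subspace K"
      unfolding subspace_def
    proof (intro conjI ballI allI)
      show "0 \<in> K"
      proof -
        have "\<theta> u 0 = (\<Sum>b\<in>F. \<theta> b 0)" using F u by (simp add: \<theta>_H0 subset_iff)
        then show ?thesis unfolding K_def using subspace_0[OF subspaceH]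
          by (intro CollectI conjI exI[of _ "\<lambda>_. 0"]) simp_all
      qed
    next
      fix x y assume "x \<in> K" "y \<in> K"
      then obtain k l where kl: "x \<in> H" "y \<in> H" "\<forall>b\<in>F. k b \<in> H" "\<forall>b\<in>F. l b \<in> H"
        "\<theta> u x = (\<Sum>b\<in>F. \<theta> b (k b))" "\<theta> u y = (\<Sum>b\<in>F. \<theta> b (l b))"
        unfolding K_def by blast
      have "\<theta> u (x + y) = (\<Sum>b\<in>F. \<theta> b (k b + l b))"
        using kl F by (simp add: \<theta>_Hadd u subset_iff sum.distrib)
      then show "x + y \<in> K"
        unfolding K_def using kl subspaceH by (auto simp: subspace_add intro!: exI[of _ "\<lambda>b. k b + l b"])
    next
      fix c x assume "x \<in> K"
      then obtain k where k: "x \<in> H" "\<forall>b\<in>F. k b \<in> H" "\<theta> u x = (\<Sum>b\<in>F. \<theta> b (k b))"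
        unfolding K_def by blast
      have "\<theta> u (sV c x) = (\<Sum>b\<in>F. \<theta> b (sV c (k b)))"
        using k F by (simp add: \<theta>_Hscale u subset_iff scale_sum_right)
      then show "sV c x \<in> K"
        unfolding K_def using k subspaceH by (auto simp: subspace_scale intro!: exI[of _ "\<lambda>b. sV c (k b)"])
    qed
    show "K \<subseteq> H" by (auto simp: K_def)
    fix n x assume "x \<in> K"
    then obtain k where k: "x \<in> H" "\<forall>b\<in>F. k b \<in> H" "\<theta> u x = (\<Sum>b\<in>F. \<theta> b (k b))"
      unfolding K_def by blast
    have "\<theta> u (a n x) = (\<Sum>b\<in>F. \<theta> b (a n (k b)))"
      using k F by (simp add: \<theta>_Ha u subset_iff a_sum)
    then show "a n x \<in> K"
      unfolding K_def using k by (auto simp: a_H intro!: exI[of _ "\<lambda>b. a n (k b)"])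
  qed
  moreover have "K \<noteq> H"
  proof
    assume "K = H"
    then have "\<forall>x\<in>H. \<exists>k. (\<forall>b\<in>F. k b \<in> H) \<and> \<theta> u x = (\<Sum>b\<in>F. \<theta> b (k b))"
      unfolding K_def by blast
    from bchoice[OF this] obtain k where k: "\<And>x b. x \<in> H \<Longrightarrow> b \<in> F \<Longrightarrow> k x b \<in> H"
        "\<And>x. x \<in> H \<Longrightarrow> \<theta> u x = (\<Sum>b\<in>F. \<theta> b (k x b))"
      by blast
    \<comment> \<open>By uniqueness the chosen coefficient at \<open>b\<close> depends linearly on
      \<open>x\<close> and commutes with the modes, so it is an endomorphism of
      \<open>H\<close>.\<close>
    have "\<exists>c. \<forall>x\<in>H. k x b = sV c x" if b: "b \<in> F" for b
    proof (rule H_endo)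
      show "k x b \<in> H" if "x \<in> H" for x using k b that by blast
      show "k (x + y) b = k x b + k y b" if "x \<in> H" "y \<in> H" for x y
      proof (rule uniq[OF _ _ _ b])
        show "(\<Sum>b\<in>F. \<theta> b (k (x + y) b)) = (\<Sum>b\<in>F. \<theta> b (k x b + k y b))"
          using that F subspaceH
          by (simp add: k(1) k(2)[symmetric] \<theta>_Hadd u subset_iff sum.distrib subspace_add)
      qed (use that subspaceH in \<open>simp_all add: k(1) subspace_add\<close>)
      show "k (sV c x) b = sV c (k x b)" if "x \<in> H" for x c
      proof (rule uniq[OF _ _ _ b])
        show "(\<Sum>b\<in>F. \<theta> b (k (sV c x) b)) = (\<Sum>b\<in>F. \<theta> b (sV c (k x b)))"
          using that F subspaceH
          by (simp add: k(1) k(2)[symmetric] \<theta>_Hscale u subset_iff scale_sum_right[symmetric] subspace_scale)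
      qed (use that subspaceH in \<open>simp_all add: k(1) subspace_scale\<close>)
      show "k (a n x) b = a n (k x b)" if "x \<in> H" for x n
      proof (rule uniq[OF _ _ _ b])
        show "(\<Sum>b\<in>F. \<theta> b (k (a n x) b)) = (\<Sum>b\<in>F. \<theta> b (a n (k x b)))"
          using that F by (simp add: k(1) k(2)[symmetric] \<theta>_Ha u subset_iff a_sum[symmetric] a_H)
      qed (use that in \<open>simp_all add: k(1) a_H\<close>)
    qed
    then have "\<forall>b\<in>F. \<exists>c. \<forall>x\<in>H. k x b = sV c x" by blast
    from bchoice[OF this] obtain c where c: "\<And>b x. b \<in> F \<Longrightarrow> x \<in> H \<Longrightarrow> k x b = sV (c b) x" by blast
    \<comment> \<open>Evaluated at \<open>h0\<close>, the relation turns into one between the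
      elements of \<open>U\<close> themselves, because \<open>R (\<theta> b h0) = b\<close>.\<close>
    have "\<theta> u h0 = (\<Sum>b\<in>F. \<theta> b (sV (c b) h0))"
      using k(2)[OF h0(1)] c h0 by simp
    also have "\<dots> = (\<Sum>b\<in>F. sV (c b) (\<theta> b h0))"
      using F h0 by (intro sum.cong refl \<theta>_Hscale) auto
    finally have "R (\<theta> u h0) = (\<Sum>b\<in>F. fsc (c b) (R (\<theta> b h0)))"
      by (simp add: R_sum R_scale)
    also have "\<dots> = (\<Sum>b\<in>F. fsc (c b) b)"
      using F by (intro sum.cong refl) (auto simp: R_\<theta>)
    finally have "u = (\<Sum>b\<in>F. fsc (c b) b)" by (simp add: R_\<theta> u)
    moreover have "(\<Sum>b\<in>F. fsc (c b) b) \<in> fs.span F"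
      by (intro fs.span_sum fs.span_scale fs.span_base)
    ultimately show False using uF by simp
  qed
  ultimately have K: "K = {0}" by blast
  have hu: "h u \<in> H" and hF: "\<And>b. b \<in> F \<Longrightarrow> h b \<in> H"
    using insert.prems(3) by blast+
  have sum0: "\<theta> u (h u) + (\<Sum>b\<in>F. \<theta> b (h b)) = 0"
    using insert.prems(4) insert.hyps by simp
  have "(\<Sum>b\<in>F. \<theta> b (- h b)) = (\<Sum>b\<in>F. - \<theta> b (h b))"
  proof (rule sum.cong[OF refl])
    fix b assume "b \<in> F"
    then have "b \<in> U" "h b \<in> H" using F hF by blast+
    from \<theta>_Hscale[OF this, of "- 1"] show "\<theta> b (- h b) = - \<theta> b (h b)" by simp
  qed
  also have "\<dots> = \<theta> u (h u)"
    unfolding sum_negf by (rule minus_unique) (use sum0 in \<open>simp only: add.commute\<close>)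
  finally have "h u \<in> K"
    unfolding K_def using hu hF subspace_neg[OF subspaceH]
    by (intro CollectI conjI exI[of _ "\<lambda>b. - h b"]) simp_all
  then have hu0: "h u = 0" using K by blast
  show ?case
  proof (cases "b = u")
    case False
    have "(\<Sum>b\<in>F. \<theta> b (h b)) = 0" using sum0 u by (simp add: hu0 \<theta>_H0)
    moreover have "b \<in> F" using False insert.prems(5) by blast
    ultimately show ?thesis using insert.IH[OF F indF, of h b] hF by blast
  qed (simp add: hu0)
qed simp

section \<open>The tensor product decomposition\<close>

text \<open>The image of \<open>H \<otimes> W\<close> in \<open>V\<close> under evaluation.\<close>

definition tspan :: "('v \<Rightarrow> complex) set \<Rightarrow> 'v set" where
  "tspan W = span {\<theta> w h | h w. h \<in> H \<and> w \<in> W}"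

text \<open>Evaluation is equivariant for the tensor product action: \<open>\<theta> w\<close>
  commutes with the oscillator part, and the remaining \<open>bar\<close> part is by construction
  the action on \<open>U\<close>.\<close>

lemma \<rho>_\<theta>: "w \<in> U \<Longrightarrow> h \<in> H \<Longrightarrow> \<rho> g (\<theta> w h) = \<theta> w (Hm g h) + \<theta> (\<rho>U g w) h"
  by (simp add: Hom_Hm[OF \<theta>_Homs] \<theta>_\<rho>U bar_def)

lemma \<rho>_zero: "\<rho> g 0 = 0"
  using \<rho>_scale[of g 0 0] by simp

lemma tspan_invariant:
  assumes W: "W \<subseteq> U" "\<And>g w. w \<in> W \<Longrightarrow> \<rho>U g w \<in> W" and x: "x \<in> tspan W"
  shows "\<rho> g x \<in> tspan W"
  using x unfolding tspan_def
proof (induction rule: span_induct_alt)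
  case base
  then show ?case by (simp add: \<rho>_zero span_zero)
next
  case (step c x y)
  then obtain h w where hw: "h \<in> H" "w \<in> W" "x = \<theta> w h" by blast
  have gen: "\<theta> w' h' \<in> span {\<theta> w h | h w. h \<in> H \<and> w \<in> W}" if "h' \<in> H" "w' \<in> W" for h' w'
    using that by (intro span_base) blast
  have "w \<in> U" using hw W by blast
  then have "\<rho> g (sV c x + y) = sV c (\<theta> w (Hm g h) + \<theta> (\<rho>U g w) h) + \<rho> g y"
    using hw by (simp add: \<rho>_add \<rho>_scale \<rho>_\<theta>)
  also have "\<dots> \<in> span {\<theta> w h | h w. h \<in> H \<and> w \<in> W}"
    using hw W(2) step by (intro span_add span_scale gen Hm_H) simp_all
  finally show ?case .
qed

lemma tspan_trivial:
  assumes "W \<subseteq> U" "\<And>g w. w \<in> W \<Longrightarrow> \<rho>U g w \<in> W"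
  shows "tspan W = {0} \<or> tspan W = UNIV"
proof (rule simple_rep_submodule[OF simpleV])
  show "subspace (tspan W)" unfolding tspan_def by (rule subspace_span)
  show "\<rho> g x \<in> tspan W" if "x \<in> tspan W" for g x using assms that by (rule tspan_invariant)
qed simp

lemma \<theta>_in_tspan: "h \<in> H \<Longrightarrow> w \<in> W \<Longrightarrow> \<theta> w h \<in> tspan W"
  unfolding tspan_def by (rule span_base) blast

lemma U_nontrivial: "\<exists>u\<in>U. u \<noteq> 0"
proof
  let ?f = "\<lambda>x. if x \<in> H then x else 0"
  have f: "?f \<in> Homs"
    using subspaceH by (auto simp: Homs_def a_H subspace_add subspace_scale)
  show "R (?f h0) \<in> U" using R_Homs[OF f] .
  show "R (?f h0) \<noteq> 0" using h0 R_eq_iff[of h0 0] by (simp add: R_zero)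
qed

lemma bilinear_\<theta>:
  assumes "B \<subseteq> U"
  shows "bilinear_mod sV sV fsc {0} H B (\<lambda>h u. \<theta> u h)"
proof -
  have "fs.span B \<subseteq> U" using assms subspaceU by (rule fs.span_minimal)
  then have U: "u \<in> fs.span B \<Longrightarrow> u \<in> U" for u by blast
  show ?thesis
    by unfold_locales
      (simp_all add: U subspaceH subspace_0 subspace_single_0 \<theta>_Hadd \<theta>_Hscale \<theta>_add \<theta>_scale)
qed

text \<open>This recovers \<open>W\<close> from the image of \<open>H \<otimes> W\<close>. If
  \<open>u\<close> were outside \<open>W\<close>, adjoining it to the basis elements that occur in
  the normal form of \<open>\<theta> u h\<close> would give a relation excluded by
  \<open>independent_isotypic\<close>.\<close>

lemma tspan_independent:
  assumes W: "fs.subspace W" "W \<subseteq> U" and u: "u \<in> U" and h: "h \<in> H" "h \<noteq> 0"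
    and ts: "\<theta> u h \<in> tspan W"
  shows "u \<in> W"
proof (rule ccontr)
  assume uW: "u \<notin> W"
  obtain B where B: "B \<subseteq> W" "fs.independent B" "W \<subseteq> fs.span B"
    using fs.maximal_independent_subset by blast
  have spB: "fs.span B = W"
    using B W(1) fs.span_minimal by blast
  have "B \<subseteq> U" using B W by blast
  interpret bilinear_mod sV sV fsc "{0}" H B "\<lambda>h u. \<theta> u h"
    by (rule bilinear_\<theta>) fact
  have "normal (\<theta> u h)"
    using ts by (intro normal_span) (simp add: spB tspan_def)
  then obtain F k where F: "finite F" "F \<subseteq> B" "\<And>b. k b \<in> H" "\<theta> u h = (\<Sum>b\<in>F. \<theta> b (k b))"
    unfolding normal_def by auto
  have uF: "u \<notin> fs.span F"
    using uW spB fs.span_mono[OF F(2)] by blast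
  then have "u \<notin> F" using fs.span_base by blast
  \<comment> \<open>The coefficient \<open>- h\<close> at \<open>u\<close> moves
    \<open>\<theta> u h\<close> to the other side of the relation.\<close>
  define l where "l b = (if b = u then - h else k b)" for b
  have "(\<Sum>b\<in>insert u F. \<theta> b (l b)) = \<theta> u (- h) + (\<Sum>b\<in>F. \<theta> b (k b))"
  proof -
    have "(\<Sum>b\<in>F. \<theta> b (l b)) = (\<Sum>b\<in>F. \<theta> b (k b))"
      using \<open>u \<notin> F\<close> by (intro sum.cong refl) (auto simp: l_def)
    then show ?thesis using F(1) \<open>u \<notin> F\<close> by (simp add: l_def)
  qed
  also have "\<dots> = 0"
    using \<theta>_Hscale[OF u h(1), of "- 1"] F(4) by simp
  finally have 0: "(\<Sum>b\<in>insert u F. \<theta> b (l b)) = 0" .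
  have "fs.independent (insert u F)"
    using uF fs.independent_mono[OF B(2) F(2)] by (rule fs.independent_insertI)
  moreover have "insert u F \<subseteq> U" using u F B W by blast
  moreover have "l b \<in> H" for b
    using F(3) subspace_neg[OF subspaceH h(1)] by (simp add: l_def)
  ultimately have "l u = 0"
    using independent_isotypic[of "insert u F" l u] F(1) 0 by blast
  then show False using h by (simp add: l_def)
qed

text \<open>The Virasoro relations are those of \<open>bar\<close>, read at \<open>h0\<close>. A
  submodule \<open>W\<close> gives the submodule \<open>tspan W\<close> of \<open>V\<close>, which
  is zero or everything, and each case determines \<open>W\<close>.\<close>

lemma simple_U: "simple_rep Virgens fsc U \<rho>U"
  unfolding simple_rep_def lie_rep_def
proof (intro conjI ballI allI impI)
  show "fs.subspace U" by (rule subspaceU)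
  show "\<rho>U g u \<in> U" if "u \<in> U" for g u using that by (rule \<rho>U_closed)
  show "\<rho>U g (u + w) = \<rho>U g u + \<rho>U g w" if "u \<in> U" "w \<in> U" for g u w
    using that by (simp only: \<rho>U_def \<theta>_add bar_add R_add)
  show "\<rho>U g (fsc c u) = fsc c (\<rho>U g u)" if "u \<in> U" for g u c
    using that by (simp only: \<rho>U_def \<theta>_scale bar_scale R_scale)
  show "\<rho>U x (\<rho>U y u) - \<rho>U y (\<rho>U x u) = (\<Sum>g\<in>{g. br x y g \<noteq> 0}. fsc (br x y g) (\<rho>U g u))"
    if "x \<in> Virgens" "y \<in> Virgens" "u \<in> U" for x y u
  proof -
    have "\<rho>U x (\<rho>U y u) - \<rho>U y (\<rho>U x u)
        = R (bar x (bar y (\<theta> u h0)) - bar y (bar x (\<theta> u h0)))"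
      unfolding \<rho>U_def[of x "\<rho>U y u"] \<rho>U_def[of y "\<rho>U x u"] \<theta>_\<rho>U[OF that(3)] R_diff ..
    then show ?thesis
      unfolding bar_bracket[OF that(1,2)] by (simp only: R_sum R_scale \<rho>U_def)
  qed
  show "U \<noteq> {0}" using U_nontrivial by blast
  fix W assume W: "fs.subspace W \<and> W \<subseteq> U \<and> (\<forall>g\<in>Virgens. \<forall>w\<in>W. \<rho>U g w \<in> W)"
  \<comment> \<open>Invariance of \<open>tspan W\<close> requires stability under all generators;
    those outside Vir act on \<open>U\<close> by zero.\<close>
  have stable: "\<rho>U g w \<in> W" if "w \<in> W" for g w
  proof (cases "g \<in> Virgens")
    case False
    then have "bar g v = 0" for v
      by (cases g) (auto simp: Virgens_def bar_trivial)
    then have "\<rho>U g w = 0" by (simp only: \<rho>U_def R_zero)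
    moreover have "0 \<in> W" using W fs.subspace_0 by blast
    ultimately show ?thesis by (simp only:)
  qed (use W that in blast)
  consider "tspan W = {0}" | "tspan W = UNIV"
    using tspan_trivial[of W] W stable by blast
  then show "W = {0} \<or> W = U"
  proof cases
    case 1
    have "w = 0" if "w \<in> W" for w
    proof -
      have "\<theta> w h0 = 0" using \<theta>_in_tspan[OF h0(1) that] 1 by blast
      moreover have "w \<in> U" using that W by blast
      ultimately show ?thesis using R_\<theta> R_zero by metis
    qed
    then show ?thesis using W fs.subspace_0 by blast
  next
    case 2
    have "u \<in> W" if "u \<in> U" for u
      using tspan_independent[of W u h0] W that h0 2 by blast
    then show ?thesis using W by blast
  qed
qed

lemma in_O_U: "in_O Virgens U \<rho>U"
  unfolding in_O_def
proof (intro ballI)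
  fix u assume "u \<in> U"
  let ?v = "\<theta> u h0"
  obtain n where n: "\<And>g. n \<le> deg g \<Longrightarrow> \<rho> g ?v = 0"
    using inO unfolding in_O_def Lgens_def by blast
  obtain N where N: "\<forall>k\<ge>N. sug a k ?v = 0" using sug_eventually_zero by blast
  \<comment> \<open>The bound 1 excludes \<open>Z1\<close>, which has degree 0. A bound for the
    single vector \<open>\<theta> u h0\<close> suffices, because \<open>\<rho>U\<close> is read off
    there.\<close>
  have "\<rho>U g u = 0" if g: "g \<in> Virgens" "max 1 (max n N) \<le> deg g" for g
  proof -
    obtain k where k: "g = D k" using g by (auto simp: Virgens_def)
    then have "\<rho> g ?v = 0" "a k ?v = 0" "sug a k ?v = 0" using g n N by simp_all
    then have "bar g ?v = 0" by (simp add: bar_def k)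
    then show ?thesis by (simp only: \<rho>U_def R_zero)
  qed
  then show "\<exists>n>0. \<forall>g\<in>Virgens. n \<le> deg g \<longrightarrow> \<rho>U g u = 0"
    by (intro exI[of _ "max 1 (max n N)"]) simp
qed

section \<open>The evaluation map on formal sums and its kernel\<close>

definition \<psi> :: "('v \<times> ('v \<Rightarrow> complex) \<Rightarrow> complex) \<Rightarrow> 'v" where
  "\<psi> = lext sV (\<lambda>p. \<theta> (snd p) (fst p))"

abbreviation FT :: "('v \<times> ('v \<Rightarrow> complex) \<Rightarrow> complex) set" where "FT \<equiv> free_tens H U"
abbreviation TS :: "('v \<times> ('v \<Rightarrow> complex) \<Rightarrow> complex) set" where "TS \<equiv> tens_sub sV fsc H U"

lemma \<psi>_pt: "\<psi> (pt h u) = \<theta> u h"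
  by (simp add: \<psi>_def lext_pt)

lemma \<psi>_add: "f \<in> FT \<Longrightarrow> g \<in> FT \<Longrightarrow> \<psi> (f + g) = \<psi> f + \<psi> g"
  unfolding \<psi>_def by (intro lext_add free_tens_finite)

lemma \<psi>_scale: "f \<in> FT \<Longrightarrow> \<psi> (fsc c f) = sV c (\<psi> f)"
  unfolding \<psi>_def by (intro lext_fsc free_tens_finite)

lemma \<psi>_zero: "\<psi> 0 = 0"
  by (simp only: \<psi>_def lext_zero)

lemma \<psi>_diff: "f \<in> FT \<Longrightarrow> g \<in> FT \<Longrightarrow> \<psi> (f - g) = \<psi> f - \<psi> g"
  using \<psi>_add[of "f - g" g] fs.subspace_diff[OF free_tens_subspace, of f H U g] by simp

lemma \<psi>_sum: "(\<And>i. i \<in> A \<Longrightarrow> f i \<in> FT) \<Longrightarrow> \<psi> (\<Sum>i\<in>A. f i) = (\<Sum>i\<in>A. \<psi> (f i))"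
proof (induction A rule: infinite_finite_induct)
  case (insert i A)
  then have "(\<Sum>i\<in>A. f i) \<in> FT" by (intro fs.subspace_sum free_tens_subspace) simp
  then show ?case
    using insert.prems insert.IH by (simp only: sum.insert[OF insert.hyps] \<psi>_add insertI1 insertI2)
qed (simp_all add: \<psi>_zero del: zero_fun_apply)

lemma kernel_subspace: "fs.subspace {f \<in> FT. \<psi> f = 0}"
  unfolding fs.subspace_def
  by (simp add: \<psi>_zero \<psi>_add \<psi>_scale fs.subspace_0[OF free_tens_subspace]
      fs.subspace_add[OF free_tens_subspace] fs.subspace_scale[OF free_tens_subspace])

lemma TS_kernel: "TS \<subseteq> {f \<in> FT. \<psi> f = 0}"
  unfolding tens_sub_def
proof (rule fs.span_minimal[OF _ kernel_subspace])
  have pt: "pt h u \<in> FT" if "h \<in> H" "u \<in> U" for h u using that by (rule pt_free_tens)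
  note diff = fs.subspace_diff[OF free_tens_subspace]
  note sc = fs.subspace_scale[OF free_tens_subspace]
  show "tens_rel sV fsc H U \<subseteq> {f \<in> FT. \<psi> f = 0}"
  proof
    fix f assume "f \<in> tens_rel sV fsc H U"
    then consider
        (1) h h' u where "f = pt (h + h') u - pt h u - pt h' u" "h \<in> H" "h' \<in> H" "u \<in> U"
      | (2) h u u' where "f = pt h (u + u') - pt h u - pt h u'" "h \<in> H" "u \<in> U" "u' \<in> U"
      | (3) h u c where "f = pt (sV c h) u - fsc c (pt h u)" "h \<in> H" "u \<in> U"
      | (4) h u c where "f = pt h (fsc c u) - fsc c (pt h u)" "h \<in> H" "u \<in> U"
      unfolding tens_rel_def by blast
    then show "f \<in> {f \<in> FT. \<psi> f = 0}"
    proof cases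
      case 1
      then have "h + h' \<in> H" using subspace_add[OF subspaceH] by blast
      then show ?thesis using 1 by (simp add: diff pt \<psi>_diff \<psi>_pt \<theta>_Hadd)
    next
      case 2
      then show ?thesis by (simp add: diff pt U_add \<psi>_diff \<psi>_pt \<theta>_add)
    next
      case 3
      then have "sV c h \<in> H" using subspace_scale[OF subspaceH] by blast
      then show ?thesis using 3 by (simp add: diff sc pt \<psi>_diff \<psi>_scale \<psi>_pt \<theta>_Hscale)
    next
      case 4
      then show ?thesis by (simp add: diff sc pt U_scale \<psi>_diff \<psi>_scale \<psi>_pt \<theta>_scale)
    qed
  qed
qed

text \<open>Injectivity of evaluation on the tensor product. Modulo the relations \<open>f\<close>
  is a sum of terms \<open>pt (k b) b\<close> with independent \<open>b\<close>; by
  \<open>independent_isotypic\<close> all \<open>k b\<close> vanish, and each \<open>pt 0 b\<close>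
  lies in the span of the relations.\<close>

lemma kernel_TS:
  assumes f: "f \<in> FT" "\<psi> f = 0"
  shows "f \<in> TS"
proof -
  obtain B where B: "B \<subseteq> U" "fs.independent B" "U \<subseteq> fs.span B"
    using fs.maximal_independent_subset by blast
  have spB: "fs.span B = U"
    using B subspaceU fs.span_minimal by blast
  have TS: "fs.subspace TS" unfolding tens_sub_def by (rule fs.subspace_span)
  have rel: "x \<in> tens_rel sV fsc H U \<Longrightarrow> x \<in> TS" for x
    unfolding tens_sub_def by (rule fs.span_base)
  interpret bilinear_mod fsc sV fsc TS H B pt
  proof
    show "fs.subspace TS" "subspace H" by (rule TS subspaceH)+
    fix h h' u u' c
    assume h: "h \<in> H" and "u \<in> fs.span B"
    then have u: "u \<in> U" by (simp only: spB)
    show "pt (h + h') u - pt h u - pt h' u \<in> TS" if "h' \<in> H"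
      by (rule rel) (unfold tens_rel_def, use h that u in blast)
    show "pt h (u + u') - pt h u - pt h u' \<in> TS" if "u' \<in> fs.span B"
      by (rule rel) (unfold tens_rel_def, use h that u spB in blast)
    show "pt (sV c h) u - fsc c (pt h u) \<in> TS"
      by (rule rel) (unfold tens_rel_def, use h u in blast)
    show "pt h (fsc c u) - fsc c (pt h u) \<in> TS"
      by (rule rel) (unfold tens_rel_def, use h u in blast)
  qed
  have "f \<in> fs.span {pt h u | h u. h \<in> H \<and> u \<in> fs.span B}"
    using free_tens_span f unfolding spB by blast
  then have "normal f" by (rule normal_span)
  then obtain F k where F: "finite F" "F \<subseteq> B" "\<And>b. k b \<in> H" "f - (\<Sum>b\<in>F. pt (k b) b) \<in> TS"
    unfolding normal_def by blast
  let ?s = "\<Sum>b\<in>F. pt (k b) b"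
  have FU: "F \<subseteq> U" using F B by blast
  have pt: "pt (k b) b \<in> FT" if "b \<in> F" for b
    using that F FU by (intro pt_free_tens) auto
  then have s: "?s \<in> FT" by (intro fs.subspace_sum free_tens_subspace)
  have "\<psi> (f - ?s) = 0" using F(4) TS_kernel by blast
  then have "\<psi> ?s = 0" using f s by (simp add: \<psi>_diff)
  then have "(\<Sum>b\<in>F. \<theta> b (k b)) = 0" using pt by (simp add: \<psi>_sum \<psi>_pt)
  then have "k b = 0" if "b \<in> F" for b
    using independent_isotypic[of F k b] that F(1,3) FU fs.independent_mono[OF B(2) F(2)] by blast
  then have "pt (k b) b \<in> TS" if "b \<in> F" for b
    using zero_l[of b] that F(2) fs.span_base[of b B] by (simp only: subsetD)
  then have "?s \<in> TS" by (intro fs.subspace_sum TS)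
  from fs.subspace_add[OF TS F(4) this] show ?thesis by simp
qed

text \<open>The image contains \<open>tspan U\<close>, which is a submodule of \<open>V\<close>, and
  nonzero because \<open>U\<close> contains the inclusion of \<open>H\<close>.\<close>

lemma \<psi>_surj: "\<exists>f\<in>FT. \<psi> f = v"
proof -
  have "tspan U \<noteq> {0}"
  proof -
    obtain u where u: "u \<in> U" "u \<noteq> 0" using U_nontrivial by blast
    then have "\<theta> u h0 \<noteq> 0" using R_\<theta>[OF u(1)] R_zero by auto
    then show ?thesis using \<theta>_in_tspan[OF h0(1) u(1)] by blast
  qed
  then have "tspan U = UNIV" using tspan_trivial[OF subset_refl \<rho>U_closed] by simp
  moreover have "tspan U \<subseteq> \<psi> ` FT"
    unfolding tspan_def
  proof (rule span_minimal)
    show "{\<theta> w h |h w. h \<in> H \<and> w \<in> U} \<subseteq> \<psi> ` FT"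
    proof
      fix x assume "x \<in> {\<theta> w h |h w. h \<in> H \<and> w \<in> U}"
      then obtain h w where hw: "h \<in> H" "w \<in> U" "x = \<theta> w h" by blast
      show "x \<in> \<psi> ` FT"
        by (rule image_eqI[of _ _ "pt h w"]) (simp_all only: hw \<psi>_pt pt_free_tens)
    qed
    show "subspace (\<psi> ` FT)"
      unfolding subspace_def
    proof (intro conjI ballI allI)
      show "0 \<in> \<psi> ` FT"
        by (rule image_eqI[of _ _ 0]) (simp_all add: \<psi>_zero fs.subspace_0[OF free_tens_subspace])
    next
      fix x y assume "x \<in> \<psi> ` FT" "y \<in> \<psi> ` FT"
      then obtain f g where fg: "f \<in> FT" "g \<in> FT" "x = \<psi> f" "y = \<psi> g" by blast
      then have "x + y = \<psi> (f + g)" by (simp only: \<psi>_add)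
      then show "x + y \<in> \<psi> ` FT"
        using fs.subspace_add[OF free_tens_subspace fg(1,2)] by blast
    next
      fix c x assume "x \<in> \<psi> ` FT"
      then obtain f where f: "f \<in> FT" "x = \<psi> f" by blast
      then have "sV c x = \<psi> (fsc c f)" by (simp only: \<psi>_scale)
      then show "sV c x \<in> \<psi> ` FT"
        using fs.subspace_scale[OF free_tens_subspace f(1)] by blast
    qed
  qed
  ultimately have "v \<in> \<psi> ` FT" by blast
  then show ?thesis by blast
qed

lemma Lext_\<rho>U: "Lext \<rho>U g u = \<rho>U g u"
  by (cases g) (simp_all only: Lext.simps \<rho>U_def bar_trivial R_zero)

abbreviation act where "act \<equiv> tens_act Hm (Lext \<rho>U)"

lemma act_FT: "f \<in> FT \<Longrightarrow> act g f \<in> FT"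
  by (rule tens_act_free_tens) (simp_all only: Hm_H Lext_\<rho>U \<rho>U_closed)

lemma \<rho>_sum: "\<rho> g (\<Sum>i\<in>A. f i) = (\<Sum>i\<in>A. \<rho> g (f i))"
  by (induction A rule: infinite_finite_induct) (simp_all add: \<rho>_zero \<rho>_add)

lemma \<psi>_act:
  assumes f: "f \<in> FT"
  shows "\<psi> (act g f) = \<rho> g (\<psi> f)"
proof -
  let ?S = "{p. f p \<noteq> 0}"
  have S: "fst p \<in> H" "snd p \<in> U" if "p \<in> ?S" for p
    using that f unfolding free_tens_def by auto
  let ?t = "\<lambda>p. pt (Hm g (fst p)) (snd p) + pt (fst p) (Lext \<rho>U g (snd p))"
  have pt: "pt (Hm g (fst p)) (snd p) \<in> FT" "pt (fst p) (Lext \<rho>U g (snd p)) \<in> FT" if "p \<in> ?S" for p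
    using S[OF that] by (simp_all only: pt_free_tens Hm_H Lext_\<rho>U \<rho>U_closed)
  have t: "?t p \<in> FT" if "p \<in> ?S" for p
    using pt[OF that] by (rule fs.subspace_add[OF free_tens_subspace])
  have "\<psi> (act g f) = (\<Sum>p\<in>?S. \<psi> (fsc (f p) (?t p)))"
    unfolding tens_act_def
    by (rule \<psi>_sum) (rule fs.subspace_scale[OF free_tens_subspace t])
  also have "\<dots> = (\<Sum>p\<in>?S. sV (f p) (\<rho> g (\<theta> (snd p) (fst p))))"
  proof (rule sum.cong[OF refl])
    fix p assume p: "p \<in> ?S"
    show "\<psi> (fsc (f p) (?t p)) = sV (f p) (\<rho> g (\<theta> (snd p) (fst p)))"
      unfolding \<psi>_scale[OF t[OF p]] \<psi>_add[OF pt[OF p]] \<psi>_pt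
      unfolding Lext_\<rho>U \<rho>_\<theta>[OF S(2,1)[OF p]] ..
  qed
  also have "\<dots> = \<rho> g (\<psi> f)"
    by (simp only: \<psi>_def lext_def \<rho>_sum \<rho>_scale)
  finally show ?thesis .
qed

lemma iso: "iso_tensor sV UNIV \<rho> sV H Hm fsc U (Lext \<rho>U)"
proof -
  \<comment> \<open>The isomorphism is given inversely, as the fibre of \<open>\<psi>\<close> over
    \<open>x\<close>. Fibres are exactly cosets because the kernel is \<open>TS\<close>, so no
    representatives have to be chosen.\<close>
  define \<phi> where "\<phi> x = {f \<in> FT. \<psi> f = x}" for x
  have coset: "\<phi> (\<psi> f) = coset sV fsc H U f" if f: "f \<in> FT" for f
  proof (intro equalityI subsetI)
    fix g assume "g \<in> \<phi> (\<psi> f)"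
    then have g: "g \<in> FT" "\<psi> g = \<psi> f" by (simp_all add: \<phi>_def)
    then have "g - f \<in> TS"
      using f by (intro kernel_TS fs.subspace_diff[OF free_tens_subspace]) (simp_all add: \<psi>_diff)
    then show "g \<in> coset sV fsc H U f"
      unfolding coset_def by (intro CollectI exI[of _ "g - f"]) simp
  next
    fix g assume "g \<in> coset sV fsc H U f"
    then obtain r where r: "g = f + r" "r \<in> FT" "\<psi> r = 0"
      unfolding coset_def using TS_kernel by blast
    then show "g \<in> \<phi> (\<psi> f)"
      using f fs.subspace_add[OF free_tens_subspace f r(2)] by (simp add: \<phi>_def \<psi>_add)
  qed
  have bij: "bij_betw \<phi> UNIV (tens_carrier sV fsc H U)"
    unfolding bij_betw_def
  proof
    show "inj \<phi>"
    proof (rule injI)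
      fix x y assume eq: "\<phi> x = \<phi> y"
      obtain f where "f \<in> FT" "\<psi> f = x" using \<psi>_surj by blast
      then have "f \<in> \<phi> x" by (simp add: \<phi>_def)
      then show "x = y" using eq unfolding \<phi>_def by blast
    qed
    show "range \<phi> = tens_carrier sV fsc H U"
      unfolding tens_carrier_def
    proof (intro equalityI subsetI)
      fix X assume "X \<in> range \<phi>"
      then obtain x where "X = \<phi> x" by blast
      moreover obtain f where "f \<in> FT" "\<psi> f = x" using \<psi>_surj by blast
      ultimately show "X \<in> coset sV fsc H U ` FT" using coset by blast
    next
      fix X assume "X \<in> coset sV fsc H U ` FT"
      then show "X \<in> range \<phi>" using coset by blast
    qed
  qed
  have add: "\<phi> (x + y) = coset sV fsc H U (f + g)" if "f \<in> \<phi> x" "g \<in> \<phi> y" for x y f g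
  proof -
    have fg: "f \<in> FT" "g \<in> FT" "\<psi> f = x" "\<psi> g = y" using that by (simp_all add: \<phi>_def)
    then have "x + y = \<psi> (f + g)" by (simp only: \<psi>_add)
    then show ?thesis using coset fs.subspace_add[OF free_tens_subspace fg(1,2)] by simp
  qed
  have scale: "\<phi> (sV c x) = coset sV fsc H U (fsc c f)" if "f \<in> \<phi> x" for x c f
  proof -
    have f: "f \<in> FT" "\<psi> f = x" using that by (simp_all add: \<phi>_def)
    then have "sV c x = \<psi> (fsc c f)" by (simp only: \<psi>_scale)
    then show ?thesis using coset fs.subspace_scale[OF free_tens_subspace f(1)] by simp
  qed
  have action: "\<phi> (\<rho> g x) = coset sV fsc H U (act g f)" if "f \<in> \<phi> x" for x g f
  proof -
    have f: "f \<in> FT" "\<psi> f = x" using that by (simp_all add: \<phi>_def)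
    then have "\<rho> g x = \<psi> (act g f)" by (simp only: \<psi>_act)
    then show ?thesis using coset act_FT[OF f(1)] by simp
  qed
  show ?thesis
    unfolding iso_tensor_def
    by (intro exI[of _ \<phi>] conjI ballI allI)
      (rule bij | rule add, assumption, assumption | rule scale, assumption | rule action, assumption)+
qed

end

theorem theorem12:
  fixes sV :: "complex \<Rightarrow> 'v::ab_group_add \<Rightarrow> 'v"
    and \<rho> :: "Lgen \<Rightarrow> 'v \<Rightarrow> 'v"
    and H :: "'v set"
  assumes "vector_space sV"
    and "simple_rep Lgens sV UNIV \<rho>"
    and "in_O Lgens UNIV \<rho>"
    and "\<exists>v. \<rho> Z3 v \<noteq> 0"
    and "simple_rep Hgens sV H \<rho>"
  shows "\<exists>(dz2::complex) (dz3::complex) (U::('v \<Rightarrow> complex) set) \<rho>U.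
           dz3 \<noteq> 0 \<and> (\<forall>h\<in>H. \<rho> Z3 h = sV dz3 h)
         \<and> simple_rep Virgens fsc U \<rho>U \<and> in_O Virgens U \<rho>U
         \<and> iso_tensor sV UNIV \<rho>
              sV H (Hmod sV (\<lambda>n. \<rho> (I n)) dz2 dz3)
              fsc U (Lext \<rho>U)"
proof -
  interpret V: vector_space sV by fact
  obtain z2 where z2: "\<And>v. \<rho> Z2 v = sV z2 v"
    using central_scalar[OF assms(1,2), of Z2] by blast
  obtain z3 where z3: "\<And>v. \<rho> Z3 v = sV z3 v"
    using central_scalar[OF assms(1,2), of Z3] by blast
  have "z3 \<noteq> 0" using assms(4) z3 by auto
  obtain R :: "'v \<Rightarrow> 'v \<Rightarrow> complex" where
    R: "\<And>v w. R (v + w) = R v + R w" "\<And>c v. R (sV c v) = fsc c (R v)" "inj R"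
    using ex_coordinates[OF assms(1)] by blast
  obtain h0 where h0: "h0 \<in> H" "h0 \<noteq> 0"
    using simple_rep_nonzero[OF assms(5)] V.subspace_0[OF simple_rep_subspace[OF assms(5)]] by blast
  interpret heisenberg_submodule sV \<rho> H z2 z3 R h0
    by unfold_locales (fact assms z2 z3 R h0 \<open>z3 \<noteq> 0\<close>)+
  show ?thesis
    by (rule exI[of _ z2], rule exI[of _ z3], rule exI[of _ U], rule exI[of _ \<rho>U], intro conjI ballI)
      (rule \<open>z3 \<noteq> 0\<close> Z3 simple_U in_O_U iso)+
qed

end
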